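(* Let $J\subseteq\Delta^2_n$ be an M-convex set, with $V$, $D$, $V_1,\dots,V_r$ and $J^{\mathrm{simp}}$ as in the context. Let $f$ be a homogeneous quadratic polynomial in $x_1,\dots,x_n$ with nonnegative coefficients and support $J$ such that $\rho_f$ is a strong $\mathbb{T}_\infty$-representation of $J$. Then: (1) there exist a unique homogeneous quadratic polynomial $g$ in $r$ variables with nonnegative coefficients and support $J^{\mathrm{simp}}$ and unique $\lambda_i>0$ ($i\in V$) such that $\sum_{i\in V_j}\lambda_i=1$ for all $j\in[r]$ and $$f(x_1,\dots,x_n)=g\Big(\sum_{i\in V_1}\lambda_ix_i,\dots,\sum_{i\in V_r}\lambda_ix_i\Big);$$ (2) $f$ is Lorentzian if and only if $g$ is Lorentzian.
   Context: $\Delta^d_n=\{\alpha\in\mathbb{Z}^n_{\ge0}:\sum\alpha_i=d\}$; $J\subseteq\Delta^d_n$ is M-convex if $J\ne\emptyset$ and for all $\alpha,\beta\in J$, $i$ with $\alpha_i<\beta_i$ there is $j$ with $\alpha_j>\beta_j$ and $\alpha+e_i-e_j,\beta-e_i+e_j\in J$. For $f=\sum_\alpha c_\alpha x^\alpha/\alpha!$, $\rho_f(\alpha)=c_\alpha$ and the support is $\{\alpha:c_\alpha\neq0\}$. For $J\subseteq\Delta^2_n$ M-convex: $V$ is the set of $i\in[n]$ with $e_i+e_j\in J$ for some $j$; $D$ is the set of $i\in[n]$ with $2e_i\in J$. The relation on $V$ generated by $i\sim j$ whenever $e_i+e_j\notin J$ is an equivalence relation with classes $V_1,\dots,V_r$;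 for distinct $i,j\in V$, $e_i+e_j\in J$ iff $i,j$ lie in different classes. Let $p(i)\in[r]$ with $i\in V_{p(i)}$, and $J^{\mathrm{simp}}=\{2e_{p(i)}:i\in D\}\cup\{e_i+e_j:i,j\in[r],i\ne j\}\subseteq\Delta^2_r$. A strong $\mathbb{T}_\infty$-representation of $J\subseteq\Delta^2_n$ is a function $\rho\colon\Delta^2_n\to\mathbb{R}_{\ge0}$ with support $J$ such that for all $i,j,k,l$ (with $e_i+e_j+e_k+e_l$ coordinatewise bounded by the coordinatewise maximum of $J$) the three products $\rho(e_j+e_k)\rho(e_i+e_l)$, $\rho(e_i+e_k)\rho(e_j+e_l)$, $\rho(e_i+e_j)\rho(e_k+e_l)$ are all zero, or have maximum attained at least twice, or are all nonzero. A nonzero homogeneous $f$ of degree $d$ with nonnegative coefficients is Lorentzian if its support is M-convex and $\partial^\alpha f$ has Hessian with at most one positive eigenvalue for all $\alpha\in\Delta^{d-2}_n$ (for $d=2$: the Hessian of $f$ has at most one positive eigenvalue). *)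

theory Defs
  imports
    "HOL-Library.Poly_Mapping"
    "HOL-Library.FuncSet"
    "Jordan_Normal_Form.Char_Poly"
begin

text \<open>
  Exponent vectors are finitely supported functions and polynomials are finitely supported
  functions on exponent vectors, so that the ring structure on polynomials is the convolution
  product of \<^theory>\<open>HOL-Library.Poly_Mapping\<close>. The index set $[n]$ is \<open>{..<n}\<close>, that is,
  variables are numbered from 0.
\<close>

type_synonym expo = "nat \<Rightarrow>\<^sub>0 nat"
type_synonym rpoly = "expo \<Rightarrow>\<^sub>0 real"

abbreviation lookup :: "('a \<Rightarrow>\<^sub>0 'b::zero) \<Rightarrow> 'a \<Rightarrow> 'b" where
  "lookup \<equiv> Poly_Mapping.lookup"

abbreviation keys :: "('a \<Rightarrow>\<^sub>0 'b::zero) \<Rightarrow> 'a set" where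
  "keys \<equiv> Poly_Mapping.keys"

abbreviation unit_vec_expo :: "nat \<Rightarrow> expo" ("\<e>") where
  "\<e> i \<equiv> Poly_Mapping.single i 1"

definition Delta :: "nat \<Rightarrow> nat \<Rightarrow> expo set" where
  "Delta n d = {\<alpha>. keys \<alpha> \<subseteq> {..<n} \<and> (\<Sum>i<n. lookup \<alpha> i) = d}"

text \<open>
  Subtraction of exponent vectors is truncated; below it is only applied where the coordinate
  being decreased is positive.
\<close>

definition M_convex :: "nat \<Rightarrow> nat \<Rightarrow> expo set \<Rightarrow> bool" where
  "M_convex n d J \<longleftrightarrow> J \<subseteq> Delta n d \<and> J \<noteq> {} \<and>
     (\<forall>\<alpha>\<in>J. \<forall>\<beta>\<in>J. \<forall>i<n. lookup \<alpha> i < lookup \<beta> i \<longrightarrow>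
        (\<exists>j<n. lookup \<alpha> j > lookup \<beta> j \<and> \<alpha> + \<e> i - \<e> j \<in> J \<and> \<beta> - \<e> i + \<e> j \<in> J))"


section \<open>Simplification of an M-convex set of degree two\<close>

definition V_set :: "nat \<Rightarrow> expo set \<Rightarrow> nat set" where
  "V_set n J = {i \<in> {..<n}. \<exists>j<n. \<e> i + \<e> j \<in> J}"

definition D_set :: "nat \<Rightarrow> expo set \<Rightarrow> nat set" where
  "D_set n J = {i \<in> {..<n}. Poly_Mapping.single i 2 \<in> J}"

definition parallel_rel :: "nat \<Rightarrow> expo set \<Rightarrow> (nat \<times> nat) set" where
  "parallel_rel n J =
     \<Inter>{E. equiv (V_set n J) E \<and>
        {(i, j). i \<in> V_set n J \<and> j \<in> V_set n J \<and> \<e> i + \<e> j \<notin> J} \<subseteq> E}"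

text \<open>
  A numbering \<open>W 0, \<dots>, W (r - 1)\<close> of the equivalence classes, each class occurring once.
\<close>

definition class_numbering :: "nat \<Rightarrow> expo set \<Rightarrow> nat \<Rightarrow> (nat \<Rightarrow> nat set) \<Rightarrow> bool" where
  "class_numbering n J r W \<longleftrightarrow> bij_betw W {..<r} (V_set n J // parallel_rel n J)"

definition class_index :: "nat \<Rightarrow> (nat \<Rightarrow> nat set) \<Rightarrow> nat \<Rightarrow> nat" where
  "class_index r W i = (THE k. k < r \<and> i \<in> W k)"

definition J_simp :: "nat \<Rightarrow> expo set \<Rightarrow> nat \<Rightarrow> (nat \<Rightarrow> nat set) \<Rightarrow> expo set" where
  "J_simp n J r W =
     {Poly_Mapping.single (class_index r W i) 2 |i. i \<in> D_set n J} \<union>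
     {\<e> i + \<e> j |i j. i < r \<and> j < r \<and> i \<noteq> j}"


section \<open>Polynomials\<close>

definition homogeneous :: "nat \<Rightarrow> nat \<Rightarrow> rpoly \<Rightarrow> bool" where
  "homogeneous n d f \<longleftrightarrow> keys f \<subseteq> Delta n d"

definition nonneg_coeffs :: "rpoly \<Rightarrow> bool" where
  "nonneg_coeffs f \<longleftrightarrow> (\<forall>\<alpha>. lookup f \<alpha> \<ge> 0)"

definition polyvar :: "nat \<Rightarrow> rpoly" where
  "polyvar i = Poly_Mapping.single (\<e> i) 1"

definition polyconst :: "real \<Rightarrow> rpoly" where
  "polyconst c = Poly_Mapping.single 0 c"

definition poly_subst :: "(nat \<Rightarrow> rpoly) \<Rightarrow> rpoly \<Rightarrow> rpoly" where
  "poly_subst s g = (\<Sum>\<alpha>\<in>keys g. polyconst (lookup g \<alpha>) * (\<Prod>i\<in>keys \<alpha>. s i ^ lookup \<alpha> i))"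

definition poly_pderiv :: "nat \<Rightarrow> rpoly \<Rightarrow> rpoly" where
  "poly_pderiv i f =
     (\<Sum>\<alpha>\<in>keys f. Poly_Mapping.single (\<alpha> - \<e> i) (real (lookup \<alpha> i) * lookup f \<alpha>))"

definition poly_pderivs :: "nat \<Rightarrow> expo \<Rightarrow> rpoly \<Rightarrow> rpoly" where
  "poly_pderivs n \<alpha> f = fold (\<lambda>i. poly_pderiv i ^^ lookup \<alpha> i) [0..<n] f"

text \<open>
  The coefficients of \<open>f\<close> with respect to the normalized monomials $x^\alpha / \alpha!$.
\<close>

definition rho :: "rpoly \<Rightarrow> expo \<Rightarrow> real" where
  "rho f \<alpha> = (\<Prod>i\<in>keys \<alpha>. fact (lookup \<alpha> i)) * lookup f \<alpha>"


section \<open>Strong representations\<close>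

text \<open>The condition on the three products in a strong $T_\infty$-representation.\<close>

definition T_inf_triple :: "real \<Rightarrow> real \<Rightarrow> real \<Rightarrow> bool" where
  "T_inf_triple a b c \<longleftrightarrow>
     (a = 0 \<and> b = 0 \<and> c = 0) \<or>
     (let m = Max {a, b, c} in (a = m \<and> b = m) \<or> (a = m \<and> c = m) \<or> (b = m \<and> c = m)) \<or>
     (a \<noteq> 0 \<and> b \<noteq> 0 \<and> c \<noteq> 0)"

definition strong_T_inf_rep :: "nat \<Rightarrow> expo set \<Rightarrow> (expo \<Rightarrow> real) \<Rightarrow> bool" where
  "strong_T_inf_rep n J \<rho> \<longleftrightarrow>
     (\<forall>\<alpha>\<in>Delta n 2. \<rho> \<alpha> \<ge> 0) \<and>
     {\<alpha> \<in> Delta n 2. \<rho> \<alpha> \<noteq> 0} = J \<and>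
     (\<forall>i<n. \<forall>j<n. \<forall>k<n. \<forall>l<n.
        (\<forall>m<n. lookup (\<e> i + \<e> j + \<e> k + \<e> l) m \<le> Max ((\<lambda>\<alpha>. lookup \<alpha> m) ` J)) \<longrightarrow>
        T_inf_triple (\<rho> (\<e> j + \<e> k) * \<rho> (\<e> i + \<e> l))
                     (\<rho> (\<e> i + \<e> k) * \<rho> (\<e> j + \<e> l))
                     (\<rho> (\<e> i + \<e> j) * \<rho> (\<e> k + \<e> l)))"


section \<open>Lorentzian polynomials\<close>

text \<open>
  The Hessian of a quadratic form is constant, so its entries are the constant coefficients of
  the second partial derivatives. It is only used for quadratic forms.
\<close>

definition quadratic_hessian :: "nat \<Rightarrow> rpoly \<Rightarrow> real mat" where
  "quadratic_hessian n q =
     mat n n (\<lambda>(i, j). lookup (poly_pderiv i (poly_pderiv j q)) 0)"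

text \<open>
  Eigenvalues are counted with multiplicity. For the symmetric matrices considered here the
  algebraic and geometric multiplicities agree.
\<close>

definition at_most_one_pos_eigenvalue :: "real mat \<Rightarrow> bool" where
  "at_most_one_pos_eigenvalue A \<longleftrightarrow>
     (\<Sum>x\<in>{x. eigenvalue A x \<and> x > 0}. Polynomial.order x (char_poly A)) \<le> 1"

text \<open>
  For \<open>d < 2\<close> there is no condition on Hessians, in accordance with \<open>Delta n (d - 2)\<close>
  being empty when \<open>d - 2\<close> is read as a negative integer.
\<close>

definition lorentzian :: "nat \<Rightarrow> nat \<Rightarrow> rpoly \<Rightarrow> bool" where
  "lorentzian n d f \<longleftrightarrow> f \<noteq> 0 \<and> homogeneous n d f \<and> nonneg_coeffs f \<and> M_convex n d (keys f) \<and>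
     (d \<ge> 2 \<longrightarrow> (\<forall>\<alpha>\<in>Delta n (d - 2).
        at_most_one_pos_eigenvalue (quadratic_hessian n (poly_pderivs n \<alpha> f))))"


section \<open>Factorization through the simplification\<close>

text \<open>
  Only the values \<open>lam i\<close> for \<open>i \<in> V\<close> are meaningful, hence the extensional function space: it makes
  uniqueness of the function \<open>lam\<close> the same as uniqueness of the family indexed by \<open>V\<close>.
\<close>

definition simp_factorization ::
  "nat \<Rightarrow> expo set \<Rightarrow> nat \<Rightarrow> (nat \<Rightarrow> nat set) \<Rightarrow> rpoly \<Rightarrow> rpoly \<Rightarrow> (nat \<Rightarrow> real) \<Rightarrow> bool" where
  "simp_factorization n J r W f g lam \<longleftrightarrow>
     homogeneous r 2 g \<and> nonneg_coeffs g \<and> keys g = J_simp n J r W \<and>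
     lam \<in> V_set n J \<rightarrow>\<^sub>E {0<..} \<and>
     (\<forall>j<r. (\<Sum>i\<in>W j. lam i) = 1) \<and>
     f = poly_subst (\<lambda>j. \<Sum>i\<in>W j. polyconst (lam i) * polyvar i) g"

end

theory Submission
  imports Defs
begin

text \<open>
  Let $a_{ij} = \rho_f(e_i + e_j)$ be the Hessian of $f$ and $s_i = \sum_k a_{ik}$. For $i, j$ in the
  same class the product $a_{ij} a_{kl}$ vanishes, so the condition on the three products forces
  $a_{ik} a_{jl} = a_{jk} a_{il}$: rows within a class are proportional. Hence
  $\lambda_i = s_i / \sum_{j \sim i} s_j$, and $g$ is the quadratic form whose Hessian consists of the
  sums of the blocks of $a$; both are recovered from any factorization by summing over classes.
  For (2), the Hessian of $f$ is the pullback of that of $g$ under the linear map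
  $x \mapsto (\sum_{i \in V_j} \lambda_i x_i)_j$, which is onto. So one of the two forms is positive
  definite on some plane iff the other is, and by the spectral theorem this is the failure
  of having at most one positive eigenvalue.
\<close>

section \<open>Real symmetric matrices\<close>

text \<open>The Householder reflection along \<open>u = v - e_0\<close>, which interchanges the
  first basis vector and the unit vector \<open>v\<close>. When \<open>v = e_0\<close>, both
  \<open>u\<close> and \<open>N\<close> vanish, and since division by zero gives \<open>0\<close>,
  \<open>h\<close> is the identity.\<close>

lemma orthogonal_reflection_exists:
  fixes v :: "nat \<Rightarrow> real"
  assumes n: "0 < n" and v: "(\<Sum>i<n. v i * v i) = 1"
  shows "\<exists>h. (\<forall>i j. h i j = h j i) \<and> (\<forall>i<n. h i 0 = v i) \<and>
    (\<forall>i<n. \<forall>j<n. (\<Sum>k<n. h i k * h k j) = (if i = j then 1 else 0))"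
proof -
  define u where "u i = v i - (if i = 0 then 1 else 0)" for i
  define N where "N = (\<Sum>i<n. u i * u i)"
  define h where "h i j = (if i = j then 1 else 0) - 2 / N * (u i * u j)" for i j
  have "N = (\<Sum>i<n. v i * v i + ((if i = 0 then 1 else 0) - 2 * (if i = 0 then v i else 0)))"
    unfolding N_def u_def by (rule sum.cong) (auto simp: algebra_simps)
  also have "\<dots> = 2 - 2 * v 0"
    using n v by (simp add: sum.distrib sum_subtractf flip: sum_distrib_left)
  \<comment> \<open>This value of the squared norm makes \<open>2 / N * u 0 = -1\<close> for nonzero
    \<open>N\<close>, so column \<open>0\<close> of \<open>h\<close> is
    \<open>e_0 + u = v\<close>.\<close>
  finally have N: "N = - 2 * u 0" by (simp add: u_def)
  have u0: "u i = 0" if "N = 0" "i < n" for i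
    using that unfolding N_def by (subst (asm) sum_nonneg_eq_0_iff) auto
  have "h i 0 = v i" if "i < n" for i
  proof (cases "N = 0")
    case True
    thus ?thesis using u0[OF True that] by (simp add: h_def u_def)
  next
    case False
    hence "2 / N * u 0 = -1" using N by (simp add: field_simps)
    hence "2 / N * (u i * u 0) = - u i" by (metis mult.left_commute mult_minus1_right)
    thus ?thesis by (simp add: h_def u_def)
  qed
  moreover have "(\<Sum>k<n. h i k * h k j) = (if i = j then 1 else 0)" if ij: "i < n" "j < n" for i j
  proof -
    have "(\<Sum>k<n. h i k * h k j) =
      (\<Sum>k<n. (if k = i then if i = j then 1 else 0 else 0)
        - (if k = i then 2 / N * (u i * u j) else 0) - (if k = j then 2 / N * (u i * u j) else 0)
        + (2 / N)\<^sup>2 * u i * u j * (u k * u k))"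
      unfolding h_def by (rule sum.cong) (auto simp: algebra_simps power2_eq_square)
    also have "\<dots> = (if i = j then 1 else 0) - 4 / N * (u i * u j) + (2 / N)\<^sup>2 * u i * u j * N"
      using ij by (simp add: sum.distrib sum_subtractf N_def flip: sum_distrib_left)
    also have "\<dots> = (if i = j then 1 else 0)"
      by (cases "N = 0") (auto simp: power2_eq_square field_simps)
    finally show ?thesis .
  qed
  ultimately show ?thesis
    by (intro exI[of _ h]) (auto simp: h_def)
qed

text \<open>A complex eigenvector \<open>w = a + i b\<close> always exists. Symmetry forces its
  eigenvalue to be real, and then whichever of \<open>a\<close> and \<open>b\<close> is nonzero is a
  real eigenvector, which is normalized.\<close>

lemma symmetric_real_eigenvector_exists:
  fixes A :: "real mat"
  assumes A: "A \<in> carrier_mat n n" and sym: "transpose_mat A = A" and n: "0 < n"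
  shows "\<exists>v l. v \<in> carrier_vec n \<and> A *\<^sub>v v = l \<cdot>\<^sub>v v \<and> v \<bullet> v = 1"
proof -
  let ?C = "map_mat complex_of_real A"
  have C: "?C \<in> carrier_mat n n" using A by simp
  obtain as where as: "char_poly ?C = (\<Prod>a\<leftarrow>as. [:- a, 1:])" "length as = n"
    using char_poly_factorized[OF C] by auto
  obtain z where "z \<in> set as" using as(2) n by (cases as) auto
  hence "poly (char_poly ?C) z = 0"
    unfolding as(1) by (induct as) auto
  hence "eigenvalue ?C z" using eigenvalue_root_char_poly[OF C] by simp
  then obtain w where w: "w \<in> carrier_vec n" "w \<noteq> 0\<^sub>v n" "?C *\<^sub>v w = z \<cdot>\<^sub>v w"
    unfolding eigenvalue_def eigenvector_def using A by auto
  define a where "a = vec n (\<lambda>i. Re (w $ i))"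
  define b where "b = vec n (\<lambda>i. Im (w $ i))"
  have ab: "a \<in> carrier_vec n" "b \<in> carrier_vec n" by (auto simp: a_def b_def)
  have ev: "(\<Sum>j<n. complex_of_real (A $$ (i, j)) * w $ j) = z * w $ i" if "i < n" for i
    using arg_cong[OF w(3), of "\<lambda>x. x $ i"] that A w(1)
    by (auto simp: scalar_prod_def lessThan_atLeast0)
  have Aa: "A *\<^sub>v a = Re z \<cdot>\<^sub>v a - Im z \<cdot>\<^sub>v b"
    using A ev[THEN arg_cong[of _ _ Re]]
    by (intro eq_vecI) (auto simp: a_def b_def scalar_prod_def lessThan_atLeast0)
  have Ab: "A *\<^sub>v b = Re z \<cdot>\<^sub>v b + Im z \<cdot>\<^sub>v a"
    using A ev[THEN arg_cong[of _ _ Im]]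
    by (intro eq_vecI) (auto simp: a_def b_def scalar_prod_def lessThan_atLeast0)
  have pos: "x \<bullet> x > 0" if "x \<in> carrier_vec n" "x \<noteq> 0\<^sub>v n" for x :: "real vec"
    using conjugate_square_greater_0_vec[OF that(1)] that(2) by (simp add: conjugate_vec_def)
  have nn: "x \<bullet> x \<ge> 0" if "x \<in> carrier_vec n" for x :: "real vec"
    using that by (auto simp: scalar_prod_def intro!: sum_nonneg)
  have ab0: "a \<noteq> 0\<^sub>v n \<or> b \<noteq> 0\<^sub>v n"
  proof (rule ccontr)
    assume "\<not> ?thesis"
    hence "Re (w $ i) = 0" "Im (w $ i) = 0" if "i < n" for i
      using that unfolding a_def b_def by (metis index_vec index_zero_vec(1))+
    hence "w = 0\<^sub>v n" using w(1) by (intro eq_vecI) (auto simp: complex_eq_iff)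
    thus False using w(2) by simp
  qed
  \<comment> \<open>The two sides differ exactly by \<open>Im z\<close> times the sum of the squared
    norms of \<open>a\<close> and \<open>b\<close>.\<close>
  have "(A *\<^sub>v b) \<bullet> a = b \<bullet> (A *\<^sub>v a)"
    using transpose_vec_mult_scalar[OF A ab] unfolding sym .
  hence "Im z * (a \<bullet> a + b \<bullet> b) = 0"
    unfolding Aa Ab using ab
    by (simp add: add_scalar_prod_distrib[of _ n] scalar_prod_minus_distrib[of _ n] comm_scalar_prod[of b n a] algebra_simps)
  moreover have "a \<bullet> a + b \<bullet> b > 0"
    using ab0 pos[OF ab(1)] pos[OF ab(2)] nn[OF ab(1)] nn[OF ab(2)] by auto
  ultimately have "Im z = 0" by simp
  hence "A *\<^sub>v a = Re z \<cdot>\<^sub>v a" "A *\<^sub>v b = Re z \<cdot>\<^sub>v b"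
    using Aa Ab ab by (auto intro!: eq_vecI)
  then obtain x where x: "x \<in> carrier_vec n" "x \<noteq> 0\<^sub>v n" "A *\<^sub>v x = Re z \<cdot>\<^sub>v x"
    using ab ab0 by auto
  define v where "v = (1 / sqrt (x \<bullet> x)) \<cdot>\<^sub>v x"
  have "v \<bullet> v = 1"
    using pos[OF x(1,2)] x(1) unfolding v_def by (simp add: real_sqrt_mult_self field_simps)
  moreover have "A *\<^sub>v v = Re z \<cdot>\<^sub>v v"
    unfolding v_def using A x by (simp add: mult_mat_vec smult_smult_assoc mult.commute)
  moreover have "v \<in> carrier_vec n" using x(1) by (simp add: v_def)
  ultimately show ?thesis by blast
qed

text \<open>
  Conjugating with a reflection that maps the first basis vector to a unit eigenvector splits off
  a block of size one.
\<close>

lemma spectral_decomposition: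
  fixes A :: "real mat"
  assumes "A \<in> carrier_mat n n" and "transpose_mat A = A"
  shows "\<exists>U B. U \<in> carrier_mat n n \<and> B \<in> carrier_mat n n \<and> diagonal_mat B \<and>
    transpose_mat U * U = 1\<^sub>m n \<and> A = U * B * transpose_mat U"
  using assms
proof (induction n arbitrary: A)
  case 0
  thus ?case by (intro exI[of _ "1\<^sub>m 0"] exI[of _ A]) (auto simp: diagonal_mat_def)
next
  case (Suc m)
  let ?n = "Suc m"
  note A = Suc.prems(1)
  obtain v l where v: "v \<in> carrier_vec ?n" "A *\<^sub>v v = l \<cdot>\<^sub>v v" "v \<bullet> v = 1"
    using symmetric_real_eigenvector_exists[OF Suc.prems] by auto
  have "(\<Sum>i<?n. v $ i * v $ i) = 1"
    using v(1,3) by (simp add: scalar_prod_def lessThan_atLeast0)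
  then obtain h where h: "\<And>i j. h i j = h j i" "\<And>i. i < ?n \<Longrightarrow> h i 0 = v $ i"
    "\<And>i j. i < ?n \<Longrightarrow> j < ?n \<Longrightarrow> (\<Sum>k<?n. h i k * h k j) = (if i = j then 1 else 0)"
    using orthogonal_reflection_exists[of ?n "\<lambda>i. v $ i"] by blast
  define H where "H = mat ?n ?n (\<lambda>(i, j). h i j)"
  have H: "H \<in> carrier_mat ?n ?n" by (simp add: H_def)
  have HT: "transpose_mat H = H" using h(1) by (auto simp: H_def)
  have HH: "H * H = 1\<^sub>m ?n"
  proof (rule eq_matI)
    fix i j assume ij: "i < dim_row (1\<^sub>m ?n)" "j < dim_col (1\<^sub>m ?n)"
    thus "(H * H) $$ (i, j) = 1\<^sub>m ?n $$ (i, j)"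
      using h(3)[of i j] by (simp add: H_def scalar_prod_def lessThan_atLeast0)
  qed (simp_all add: H_def)
  have col0: "col H 0 = v"
    using v(1) h(2) by (intro eq_vecI) (auto simp: H_def)
  define C where "C = H * A * H"
  have C: "C \<in> carrier_mat ?n ?n" using H A by (simp add: C_def)
  have CT: "transpose_mat C = C"
    unfolding C_def using H A Suc.prems(2) HT
    by (simp add: transpose_mult[of _ ?n ?n _ ?n] assoc_mult_mat[of _ ?n ?n _ ?n _ ?n])
  \<comment> \<open>\<open>H\<close> maps the first basis vector to the eigenvector \<open>v\<close>
    and, being an involution, maps \<open>v\<close> back.\<close>
  have Cc: "col C 0 = l \<cdot>\<^sub>v unit_vec ?n 0"
  proof -
    have "col C 0 = (H * A) *\<^sub>v col H 0" using H A unfolding C_def by (subst col_mult2) auto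
    also have "\<dots> = H *\<^sub>v (A *\<^sub>v v)" unfolding col0 using H A v(1) by (simp add: assoc_mult_mat_vec)
    also have "\<dots> = l \<cdot>\<^sub>v (H *\<^sub>v col H 0)" using H v col0 by (simp add: mult_mat_vec)
    also have "H *\<^sub>v col H 0 = col (H * H) 0" using H by (subst col_mult2) auto
    also have "\<dots> = unit_vec ?n 0" unfolding HH by simp
    finally show ?thesis .
  qed
  define A3 where "A3 = mat m m (\<lambda>(i, j). C $$ (Suc i, Suc j))"
  define L where "L = mat 1 1 (\<lambda>_. l)"
  have A3: "A3 \<in> carrier_mat m m" and L: "L \<in> carrier_mat 1 1" by (auto simp: A3_def L_def)
  let ?FB = "\<lambda>X Y. four_block_mat X (0\<^sub>m 1 m) (0\<^sub>m m 1) Y"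
  have Ci0: "C $$ (i, 0) = (if i = 0 then l else 0)" if "i < ?n" for i
    using arg_cong[OF Cc, of "\<lambda>x. x $ i"] that C by auto
  have Cs: "C $$ (i, j) = C $$ (j, i)" if "i < ?n" "j < ?n" for i j
    using arg_cong[OF CT, of "\<lambda>x. x $$ (i, j)"] that C by auto
  \<comment> \<open>The first column determines the first row by symmetry, so both vanish off the
    corner.\<close>
  have CFB: "C = ?FB L A3"
  proof (rule eq_matI)
    fix i j assume "i < dim_row (?FB L A3)" "j < dim_col (?FB L A3)"
    hence "i < ?n" "j < ?n" using A3 L by auto
    thus "C $$ (i, j) = ?FB L A3 $$ (i, j)"
      using Ci0[of i] Ci0[of j] Cs[of i j] by (cases i; cases j) (auto simp: A3_def L_def)
  qed (use C A3 L in auto)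
  have "transpose_mat A3 = A3"
    using Cs by (intro eq_matI) (auto simp: A3_def)
  from Suc.IH[OF A3 this] obtain U B where U: "U \<in> carrier_mat m m" and B: "B \<in> carrier_mat m m"
    "diagonal_mat B" and UU: "transpose_mat U * U = 1\<^sub>m m" and A3U: "A3 = U * B * transpose_mat U"
    by auto
  let ?U = "?FB (1\<^sub>m 1) U" and ?B = "?FB L B"
  have UB: "?U \<in> carrier_mat ?n ?n" "?B \<in> carrier_mat ?n ?n" "?FB (1\<^sub>m 1) (transpose_mat U) \<in> carrier_mat ?n ?n"
    using U B L four_block_carrier_mat[of _ 1 1 _ m m] by auto
  have UT: "transpose_mat ?U = ?FB (1\<^sub>m 1) (transpose_mat U)"
    using U by (intro eq_matI) auto
  have mult: "?FB X Y * ?FB X' Y' = ?FB (X * X') (Y * Y')"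
    if "X \<in> carrier_mat 1 1" "Y \<in> carrier_mat m m" "X' \<in> carrier_mat 1 1" "Y' \<in> carrier_mat m m" for X Y X' Y' :: "real mat"
    using that by (subst mult_four_block_mat[OF that(1) _ _ that(2) that(3) _ _ that(4)]) auto
  have U1: "transpose_mat ?U * ?U = 1\<^sub>m ?n"
    unfolding UT using U UU by (subst mult) auto
  have CU: "C = ?U * ?B * transpose_mat ?U"
  proof -
    have UBt: "?U * ?B = ?FB L (U * B)" using U B L by (subst mult) auto
    show ?thesis unfolding CFB UT A3U UBt using U B L by (subst mult) auto
  qed
  have HU: "H * ?U \<in> carrier_mat ?n ?n" using H UB by simp
  have HUT: "transpose_mat (H * ?U) = transpose_mat ?U * H"
    using transpose_mult[OF H UB(1)] HT by simp
  have UTc: "transpose_mat ?U \<in> carrier_mat ?n ?n" using UB UT by simp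
  have "transpose_mat (H * ?U) * (H * ?U) = transpose_mat ?U * (H * H * ?U)"
    unfolding HUT using UTc H UB by (simp add: assoc_mult_mat[of _ ?n ?n _ ?n _ ?n])
  also have "\<dots> = 1\<^sub>m ?n" unfolding HH left_mult_one_mat[OF UB(1)] U1 ..
  finally have 1: "transpose_mat (H * ?U) * (H * ?U) = 1\<^sub>m ?n" .
  have "A = (H * H) * A * (H * H)" unfolding HH using A by simp
  also have "\<dots> = H * C * H"
    unfolding C_def using H A by (simp add: assoc_mult_mat[of _ ?n ?n _ ?n _ ?n])
  also have "\<dots> = (H * ?U) * ?B * transpose_mat (H * ?U)"
    unfolding CU HUT using H UB UTc by (simp add: assoc_mult_mat[of _ ?n ?n _ ?n _ ?n])
  finally have 2: "A = (H * ?U) * ?B * transpose_mat (H * ?U)" .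
  have "diagonal_mat ?B"
    using B L unfolding diagonal_mat_def by (fastforce simp: less_Suc_eq_0_disj)
  thus ?case using HU UB 1 2 by (intro exI[of _ "H * ?U"] exI[of _ ?B]) auto
qed


section \<open>Positive eigenvalues and positive definite planes\<close>

text \<open>The order of a root of a split polynomial is its multiplicity in the list of roots. This
  turns the count in \<open>at_most_one_pos_eigenvalue\<close> into a count of diagonal
  entries.\<close>

lemma sum_order_linear_factors:
  fixes xs :: "real list"
  defines "p \<equiv> (\<Prod>a\<leftarrow>xs. [:- a, 1:])"
  shows "(\<Sum>x\<in>{x. poly p x = 0 \<and> P x}. Polynomial.order x p) = length (filter P xs)"
proof -
  have root: "poly p x = 0 \<longleftrightarrow> x \<in> set xs" for x
    unfolding p_def by (induct xs) auto
  have ord: "Polynomial.order x p = count_list xs x" for x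
  proof -
    have "(\<Prod>a\<leftarrow>xs. [:- a, 1:]) \<noteq> 0" for xs :: "real list"
      by (auto simp: prod_list_zero_iff)
    thus ?thesis
      unfolding p_def by (induct xs) (auto simp: order_mult order_linear' simp del: mult_pCons_left)
  qed
  have "(\<Sum>x\<in>{x. poly p x = 0 \<and> P x}. Polynomial.order x p)
    = (\<Sum>x\<in>set (filter P xs). count_list (filter P xs) x)"
    by (rule sum.cong) (auto simp: root ord count_list_eq_length_filter intro!: arg_cong[of _ _ length] filter_cong)
  thus ?thesis by (simp add: sum_count_set)
qed

definition quad_form :: "nat \<Rightarrow> (nat \<Rightarrow> nat \<Rightarrow> real) \<Rightarrow> (nat \<Rightarrow> real) \<Rightarrow> real" where
  "quad_form n a x = (\<Sum>i<n. \<Sum>j<n. a i j * x i * x j)"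

text \<open>Positivity for all \<open>(s, t)\<close> other than \<open>(0, 0)\<close> already forces
  \<open>x\<close> and \<open>y\<close> to be linearly independent on the indices below
  \<open>n\<close>, so their span is a genuine plane.\<close>

definition pos_def_plane :: "nat \<Rightarrow> (nat \<Rightarrow> nat \<Rightarrow> real) \<Rightarrow> bool" where
  "pos_def_plane n a \<longleftrightarrow>
     (\<exists>x y. \<forall>s t. s \<noteq> 0 \<or> t \<noteq> 0 \<longrightarrow> quad_form n a (\<lambda>i. s * x i + t * y i) > 0)"

lemma pos_def_planeI:
  "(\<And>s t. s \<noteq> 0 \<or> t \<noteq> 0 \<Longrightarrow> quad_form n a (\<lambda>i. s * x i + t * y i) > 0) \<Longrightarrow> pos_def_plane n a"
  unfolding pos_def_plane_def by blast

text \<open>In the coordinates \<open>c\<close> of an orthonormal eigenbasis the form is the sum of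
  \<open>d k * (c x k)\<^sup>2\<close>. Two positive \<open>d k\<close> give a plane spanned by two
  eigenvectors; with at most one positive \<open>d k\<close>, every plane contains a nonzero
  combination whose coordinate \<open>k\<close> vanishes, and there the form is not
  positive.\<close>

lemma at_most_one_pos_eigenvalue_iff:
  assumes sym: "\<And>i j. i < n \<Longrightarrow> j < n \<Longrightarrow> a i j = a j i"
  shows "at_most_one_pos_eigenvalue (mat n n (\<lambda>(i, j). a i j)) \<longleftrightarrow> \<not> pos_def_plane n a"
proof -
  define A where "A = mat n n (\<lambda>(i, j). a i j)"
  have A: "A \<in> carrier_mat n n" by (simp add: A_def)
  have "transpose_mat A = A" using sym by (auto simp: A_def)
  from spectral_decomposition[OF A this] obtain U B where U: "U \<in> carrier_mat n n"
    and B: "B \<in> carrier_mat n n" "diagonal_mat B" and UU: "transpose_mat U * U = 1\<^sub>m n"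
    and AUB: "A = U * B * transpose_mat U" by auto
  define d where "d k = B $$ (k, k)" for k
  have UT: "transpose_mat U \<in> carrier_mat n n" using U by simp
  have "U * transpose_mat U = 1\<^sub>m n" using mat_mult_left_right_inverse[OF UT U UU] .
  hence "similar_mat A B"
    using A U B UT UU AUB by (intro similar_matI[of _ _ U "transpose_mat U" n]) auto
  hence "char_poly A = char_poly B" by (rule char_poly_similar)
  also have "\<dots> = (\<Prod>x\<leftarrow>diag_mat B. [:- x, 1:])"
    using B by (intro char_poly_upper_triangular[of _ n]) (auto simp: diagonal_mat_def upper_triangular_def)
  finally have cp: "char_poly A = (\<Prod>x\<leftarrow>diag_mat B. [:- x, 1:])" .
  have "(\<Sum>x\<in>{x. eigenvalue A x \<and> x > 0}. Polynomial.order x (char_poly A))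
      = length (filter (\<lambda>x. x > 0) (diag_mat B))"
    unfolding eigenvalue_root_char_poly[OF A] cp by (rule sum_order_linear_factors)
  also have "\<dots> = card {k. k < n \<and> d k > 0}"
    unfolding length_filter_conv_card using B by (intro arg_cong[of _ _ card]) (auto simp: diag_mat_def d_def)
  finally have amo: "at_most_one_pos_eigenvalue A \<longleftrightarrow> card {k. k < n \<and> d k > 0} \<le> 1"
    by (simp add: at_most_one_pos_eigenvalue_def)
  have UB: "(U * B) $$ (i, k) = U $$ (i, k) * d k" if "i < n" "k < n" for i k
  proof -
    have "(U * B) $$ (i, k) = (\<Sum>l<n. U $$ (i, l) * B $$ (l, k))"
      using U B that by (simp add: scalar_prod_def lessThan_atLeast0)
    also have "\<dots> = (\<Sum>l<n. if l = k then U $$ (i, k) * d k else 0)"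
      using B that by (intro sum.cong) (auto simp: d_def diagonal_mat_def)
    finally show ?thesis using that by simp
  qed
  have a: "a i j = (\<Sum>k<n. d k * U $$ (i, k) * U $$ (j, k))" if "i < n" "j < n" for i j
  proof -
    have "a i j = A $$ (i, j)" using that by (simp add: A_def)
    also have "\<dots> = (U * B * transpose_mat U) $$ (i, j)" by (subst AUB) (rule refl)
    also have "\<dots> = (\<Sum>k<n. (U * B) $$ (i, k) * U $$ (j, k))"
      using U B that by (simp add: scalar_prod_def lessThan_atLeast0 del: assoc_mult_mat)
    finally show ?thesis using that by (simp add: UB mult_ac)
  qed
  define c where "c x k = (\<Sum>i<n. U $$ (i, k) * x i)" for x k
  have qf: "quad_form n a x = (\<Sum>k<n. d k * (c x k)\<^sup>2)" for x
  proof -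
    have "quad_form n a x = (\<Sum>i<n. \<Sum>j<n. \<Sum>k<n. d k * (U $$ (i, k) * x i) * (U $$ (j, k) * x j))"
      unfolding quad_form_def by (intro sum.cong) (auto simp: a sum_distrib_left sum_distrib_right mult_ac)
    also have "\<dots> = (\<Sum>i<n. \<Sum>k<n. \<Sum>j<n. d k * (U $$ (i, k) * x i) * (U $$ (j, k) * x j))"
      by (intro sum.cong refl sum.swap)
    also have "\<dots> = (\<Sum>k<n. \<Sum>i<n. \<Sum>j<n. d k * (U $$ (i, k) * x i) * (U $$ (j, k) * x j))"
      by (rule sum.swap)
    also have "\<dots> = (\<Sum>k<n. d k * (c x k)\<^sup>2)"
      by (simp add: c_def power2_eq_square sum_product sum_distrib_left mult_ac)
    finally show ?thesis .
  qed
  have c_lin: "c (\<lambda>i. s * x i + t * y i) k = s * c x k + t * c y k" for s t x y k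
    by (simp add: c_def sum.distrib sum_distrib_left algebra_simps)
  have c_col: "c (\<lambda>i. U $$ (i, l)) k = (if k = l then 1 else 0)" if "k < n" "l < n" for k l
    using arg_cong[OF UU, of "\<lambda>M. M $$ (k, l)"] U that
    by (simp add: c_def scalar_prod_def lessThan_atLeast0)
  have "pos_def_plane n a \<longleftrightarrow> \<not> card {k. k < n \<and> d k > 0} \<le> 1"
  proof
    assume "\<not> card {k. k < n \<and> d k > 0} \<le> 1"
    hence "\<not> (\<forall>k\<in>{k. k < n \<and> d k > 0}. \<forall>l\<in>{k. k < n \<and> d k > 0}. k = l)"
      using card_le_Suc0_iff_eq[of "{k. k < n \<and> d k > 0}"] by simp
    then obtain k l where kl: "k < n" "l < n" "d k > 0" "d l > 0" "k \<noteq> l" by auto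
    let ?x = "\<lambda>i. U $$ (i, k)" and ?y = "\<lambda>i. U $$ (i, l)"
    have "quad_form n a (\<lambda>i. s * ?x i + t * ?y i) = d k * s\<^sup>2 + d l * t\<^sup>2" for s t
    proof -
      have "quad_form n a (\<lambda>i. s * ?x i + t * ?y i)
        = (\<Sum>m<n. (if m = k then d k * s\<^sup>2 else 0) + (if m = l then d l * t\<^sup>2 else 0))"
        unfolding qf c_lin by (rule sum.cong) (use kl in \<open>auto simp: c_col\<close>)
      thus ?thesis using kl by (simp add: sum.distrib)
    qed
    moreover have "d k * s\<^sup>2 + d l * t\<^sup>2 > 0" if "s \<noteq> 0 \<or> t \<noteq> 0" for s t
      using kl that by (cases "s = 0"; cases "t = 0") (auto intro: add_pos_pos)
    ultimately show "pos_def_plane n a" unfolding pos_def_plane_def by (intro exI[of _ ?x] exI[of _ ?y]) auto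
  next
    assume "pos_def_plane n a"
    then obtain x y where xy: "\<And>s t. s \<noteq> 0 \<or> t \<noteq> 0 \<Longrightarrow> quad_form n a (\<lambda>i. s * x i + t * y i) > 0"
      unfolding pos_def_plane_def by auto
    show "\<not> card {k. k < n \<and> d k > 0} \<le> 1"
    proof
      assume "card {k. k < n \<and> d k > 0} \<le> 1"
      hence un: "k = l" if "k < n" "d k > 0" "l < n" "d l > 0" for k l
        using card_le_Suc0_iff_eq[of "{k. k < n \<and> d k > 0}"] that by simp
      \<comment> \<open>If no \<open>d l\<close> is positive, any \<open>k\<close> will do.\<close>
      obtain k where k: "\<And>l. l < n \<Longrightarrow> d l > 0 \<Longrightarrow> l = k"
        using un by (cases "\<exists>k<n. d k > 0") blast+
      \<comment> \<open>A nontrivial combination that removes the only coordinate with a possibly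
        positive coefficient.\<close>
      obtain s t where st: "s \<noteq> 0 \<or> t \<noteq> 0" "s * c x k + t * c y k = 0"
      proof (cases "c x k = 0")
        case True thus ?thesis using that[of 1 0] by simp
      next
        case False thus ?thesis using that[of "c y k" "- c x k"] by (simp add: mult.commute)
      qed
      have "quad_form n a (\<lambda>i. s * x i + t * y i) \<le> 0"
        unfolding qf c_lin
      proof (rule sum_nonpos)
        fix l assume "l \<in> {..<n}"
        hence "d l \<le> 0 \<or> l = k" using k[of l] by force
        thus "d l * (s * c x l + t * c y l)\<^sup>2 \<le> 0" using st by (auto intro: mult_nonpos_nonneg)
      qed
      thus False using xy[OF st(1)] by simp
    qed
  qed
  thus ?thesis using amo by (simp add: A_def)
qed

section \<open>Quadratic polynomials\<close>

text \<open>
  Otherwise the simplifier turns \<^term>\<open>\<e> i\<close> into \<^term>\<open>Poly_Mapping.single i (Suc 0)\<close>, which the rules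
  about \<^term>\<open>\<e> i\<close> below no longer match.
\<close>

declare One_nat_def [simp del]

lemma lookup_unit_vec_expo_add:
  "lookup (\<e> a + \<e> b) x = (if a = x then 1 else 0) + (if b = x then 1 else 0)"
  by (simp add: lookup_add lookup_single when_def)

lemma unit_vec_expo_add_eq_iff:
  "\<e> i + \<e> j = \<e> k + \<e> l \<longleftrightarrow> (i = k \<and> j = l) \<or> (i = l \<and> j = k)"
proof
  assume eq: "\<e> i + \<e> j = \<e> k + \<e> l"
  have "lookup (\<e> i + \<e> j) x = lookup (\<e> k + \<e> l) x" for x by (simp add: eq)
  hence *: "(if i = x then 1 else 0) + (if j = x then 1 else 0)
      = (if k = x then 1 else 0) + (if l = x then 1 else (0::nat))" for x
    by (simp add: lookup_add lookup_single when_def)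
  show "(i = k \<and> j = l) \<or> (i = l \<and> j = k)"
    using *[of i] *[of j] *[of k] by (auto split: if_splits)
qed (auto simp: add.commute)

lemma unit_vec_expo_double: "\<e> i + \<e> i = Poly_Mapping.single i 2"
  by (simp add: numeral_2_eq_2 flip: single_add)

lemma Delta_0: "Delta n 0 = {0}"
proof -
  have "\<alpha> = 0" if "keys \<alpha> \<subseteq> {..<n}" "\<forall>i<n. lookup \<alpha> i = 0" for \<alpha> :: expo
    using that by (intro poly_mapping_eqI) (auto simp: in_keys_iff)
  thus ?thesis by (auto simp: Delta_def)
qed

text \<open>Reduces exponent vectors of degree two to ordered pairs of indices. A squarefree vector
  arises from two such pairs and a square from one, which is the source of the factors 2
  below.\<close>

lemma Delta_2: "Delta n 2 = {\<e> i + \<e> j |i j. i < n \<and> j < n}"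
proof (intro subset_antisym subsetI)
  fix \<alpha> assume "\<alpha> \<in> Delta n 2"
  hence a: "keys \<alpha> \<subseteq> {..<n}" "(\<Sum>i<n. lookup \<alpha> i) = 2" by (auto simp: Delta_def)
  \<comment> \<open>Removing one unit at \<open>i\<close> leaves coordinate sum 1, hence a single
    further unit vector.\<close>
  then obtain i where i: "i < n" "lookup \<alpha> i > 0"
    by (metis gr0I lessThan_iff sum.neutral zero_neq_numeral)
  have "(\<Sum>k<n. lookup \<alpha> k) = (\<Sum>k<n. lookup (\<alpha> - \<e> i) k + (if k = i then 1 else 0))"
    using i by (intro sum.cong) (auto simp: lookup_minus lookup_single when_def)
  hence "(\<Sum>k<n. lookup (\<alpha> - \<e> i) k) = 1" using a i by (simp add: sum.distrib)
  then obtain j where j: "j < n" "lookup (\<alpha> - \<e> i) j = 1" "\<And>k. k < n \<Longrightarrow> k \<noteq> j \<Longrightarrow> lookup (\<alpha> - \<e> i) k = 0"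
    by (subst (asm) sum_eq_1_iff) (auto simp: Bex_def)
  have "\<alpha> = \<e> i + \<e> j"
  proof (rule poly_mapping_eqI)
    fix k
    show "lookup \<alpha> k = lookup (\<e> i + \<e> j) k"
    proof (cases "k < n")
      case True
      thus ?thesis using j(2) j(3)[OF True] i
        by (auto simp: lookup_minus lookup_add lookup_single when_def split: if_splits)
    next
      case False
      hence "lookup \<alpha> k = 0" using a(1) by (auto simp: in_keys_iff)
      thus ?thesis using False i j(1) by (auto simp: lookup_add lookup_single when_def)
    qed
  qed
  thus "\<alpha> \<in> {\<e> i + \<e> j |i j. i < n \<and> j < n}" using i j by auto
next
  fix \<alpha> assume "\<alpha> \<in> {\<e> i + \<e> j |i j. i < n \<and> j < n}"
  then obtain i j where ij: "\<alpha> = \<e> i + \<e> j" "i < n" "j < n" by auto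
  have "keys \<alpha> \<subseteq> {..<n}" using keys_add[of "\<e> i" "\<e> j"] ij by auto
  moreover have "(\<Sum>k<n. lookup \<alpha> k) = 2"
    using ij by (simp add: lookup_add lookup_single when_def sum.distrib)
  ultimately show "\<alpha> \<in> Delta n 2" by (simp add: Delta_def)
qed

lemma keys_unit_vec_expo_add: "keys (\<e> i + \<e> j) = {i, j}"
  by (auto simp: in_keys_iff lookup_add lookup_single when_def split: if_splits)

lemma rho_unit_vec_expo_add:
  "rho q (\<e> i + \<e> j) = (if i = j then 2 else 1) * lookup q (\<e> i + \<e> j)"
proof (cases "i = j")
  case True
  thus ?thesis unfolding rho_def True unit_vec_expo_double by simp
next
  case False
  thus ?thesis by (simp add: rho_def keys_unit_vec_expo_add lookup_add lookup_single)
qed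

lemma quadratic_eqI:
  assumes "homogeneous n 2 f" "homogeneous n 2 g"
    and "\<And>i j. i < n \<Longrightarrow> j < n \<Longrightarrow> rho f (\<e> i + \<e> j) = rho g (\<e> i + \<e> j)"
  shows "f = g"
proof (rule poly_mapping_eqI)
  fix \<alpha>
  show "lookup f \<alpha> = lookup g \<alpha>"
  proof (cases "\<alpha> \<in> Delta n 2")
    case True
    then obtain i j where "\<alpha> = \<e> i + \<e> j" "i < n" "j < n" by (auto simp: Delta_2)
    thus ?thesis using assms(3)[of i j] by (auto simp: rho_unit_vec_expo_add split: if_splits)
  next
    case False
    hence "\<alpha> \<notin> keys f" "\<alpha> \<notin> keys g" using assms(1,2) by (auto simp: homogeneous_def)
    thus ?thesis by (simp add: in_keys_iff)
  qed
qed

lemma finite_Delta_2: "finite (Delta n 2)"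
proof -
  have "Delta n 2 \<subseteq> (\<lambda>(i, j). \<e> i + \<e> j) ` ({..<n} \<times> {..<n})"
    unfolding Delta_2 by auto
  thus ?thesis by (rule finite_subset) simp
qed

text \<open>
  A squarefree monomial comes from two ordered pairs and a square from one; the factor $2!$ of
  squares in \<^const>\<open>rho\<close> makes the weight $1/2$ correct in both cases.
\<close>

lemma sum_Delta_2:
  fixes h :: "expo \<Rightarrow> rpoly"
  shows "(\<Sum>\<alpha>\<in>Delta r 2. polyconst (lookup g \<alpha>) * h \<alpha>)
    = (\<Sum>s<r. \<Sum>t<r. polyconst (rho g (\<e> s + \<e> t) / 2) * h (\<e> s + \<e> t))"
proof -
  define P where "P = {..<r} \<times> {..<r}"
  define u where "u = (\<lambda>(s, t). \<e> s + \<e> t)"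
  define F where "F \<alpha> = polyconst (rho g \<alpha> / 2) * h \<alpha>" for \<alpha>
  have fin: "finite P" by (simp add: P_def)
  have img: "u ` P = Delta r 2" unfolding Delta_2 P_def u_def by force
  have F2: "F \<alpha> + F \<alpha> = polyconst (rho g \<alpha>) * h \<alpha>" for \<alpha>
    unfolding F_def polyconst_def distrib_right[symmetric] single_add[symmetric] by simp
  have "polyconst (lookup g \<alpha>) * h \<alpha> = (\<Sum>p\<in>{p \<in> P. u p = \<alpha>}. F (u p))" if \<alpha>: "\<alpha> \<in> Delta r 2" for \<alpha>
  proof -
    obtain s t where st: "\<alpha> = \<e> s + \<e> t" "s < r" "t < r" using \<alpha> unfolding Delta_2 by blast
    have fib: "{p \<in> P. u p = \<alpha>} = {(s, t), (t, s)}"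
      using st unfolding P_def u_def by (auto simp: unit_vec_expo_add_eq_iff)
    have "(\<Sum>p\<in>{p \<in> P. u p = \<alpha>}. F (u p)) = (\<Sum>p\<in>{(s, t), (t, s)}. F \<alpha>)"
      unfolding fib using st(1) by (intro sum.cong refl) (auto simp: u_def add.commute)
    also have "\<dots> = polyconst (lookup g \<alpha>) * h \<alpha>"
    proof (cases "s = t")
      case True
      thus ?thesis using st(1) by (simp add: F_def rho_unit_vec_expo_add)
    next
      case False
      hence "(\<Sum>p\<in>{(s, t), (t, s)}. F \<alpha>) = F \<alpha> + F \<alpha>" by simp
      moreover have "rho g \<alpha> = lookup g \<alpha>" using False st(1) by (simp add: rho_unit_vec_expo_add)
      ultimately show ?thesis using F2[of \<alpha>] by simp
    qed
    finally show ?thesis ..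
  qed
  hence "(\<Sum>\<alpha>\<in>Delta r 2. polyconst (lookup g \<alpha>) * h \<alpha>) = (\<Sum>\<alpha>\<in>u ` P. \<Sum>p\<in>{p \<in> P. u p = \<alpha>}. F (u p))"
    unfolding img by (intro sum.cong refl) blast
  also have "\<dots> = (\<Sum>p\<in>P. F (u p))"
    using sum.image_gen[OF fin, of "\<lambda>p. F (u p)" u] by (rule sym)
  also have "\<dots> = (\<Sum>s<r. \<Sum>t<r. F (\<e> s + \<e> t))"
    unfolding P_def u_def sum.cartesian_product by (intro sum.cong refl) auto
  finally show ?thesis by (simp only: F_def)
qed

text \<open>Summing over ordered pairs instead of monomials makes the expression bilinear in
  \<open>S\<close>, so that linear forms can be substituted and multiplied out.\<close>

lemma poly_subst_quadratic:
  assumes hom: "homogeneous r 2 g"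
  shows "poly_subst S g
    = (\<Sum>s<r. \<Sum>t<r. polyconst (rho g (\<e> s + \<e> t) / 2) * (S s * S t))"
proof -
  define m where "m \<alpha> = (\<Prod>i\<in>keys \<alpha>. S i ^ lookup \<alpha> i)" for \<alpha> :: expo
  have m: "m (\<e> s + \<e> t) = S s * S t" for s t
  proof (cases "s = t")
    case True
    have "m (Poly_Mapping.single t 2) = S t * S t" by (simp add: m_def power2_eq_square)
    thus ?thesis using True by (simp only: unit_vec_expo_double)
  next
    case False
    thus ?thesis by (simp add: m_def keys_unit_vec_expo_add lookup_add lookup_single_not_eq)
  qed
  have "poly_subst S g = (\<Sum>\<alpha>\<in>Delta r 2. polyconst (lookup g \<alpha>) * m \<alpha>)"
    \<comment> \<open>Extending the sum from the support to all monomials of degree two only adds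
      zeros.\<close>
    unfolding poly_subst_def m_def[symmetric]
  proof (rule sum.mono_neutral_left)
    show "\<forall>\<alpha>\<in>Delta r 2 - keys g. polyconst (lookup g \<alpha>) * m \<alpha> = 0"
      by (simp add: in_keys_iff polyconst_def)
  qed (use hom finite_Delta_2 in \<open>simp_all add: homogeneous_def\<close>)
  thus ?thesis by (simp only: sum_Delta_2 m)
qed

section \<open>Quadratic polynomials and their Hessians\<close>

text \<open>For symmetric \<open>a\<close> this is the quadratic polynomial with Hessian
  \<open>a\<close>; the factor \<open>1/2\<close> compensates for summing over ordered
  pairs.\<close>

definition quadratic :: "nat \<Rightarrow> (nat \<Rightarrow> nat \<Rightarrow> real) \<Rightarrow> rpoly" where
  "quadratic n a = (\<Sum>i<n. \<Sum>j<n. Poly_Mapping.single (\<e> i + \<e> j) (a i j / 2))"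

lemma homogeneous_quadratic: "homogeneous n 2 (quadratic n a)"
proof -
  have "keys (quadratic n a) \<subseteq> (\<Union>i<n. \<Union>j<n. keys (Poly_Mapping.single (\<e> i + \<e> j) (a i j / 2)))"
    unfolding quadratic_def by (intro order_trans[OF keys_sum] UN_mono keys_sum) auto
  also have "\<dots> \<subseteq> Delta n 2" by (auto simp: Delta_2)
  finally show ?thesis by (simp add: homogeneous_def)
qed

lemma rho_quadratic:
  assumes sym: "a j i = a i j" and ij: "i < n" "j < n"
  shows "rho (quadratic n a) (\<e> i + \<e> j) = a i j"
proof -
  have "lookup (quadratic n a) (\<e> i + \<e> j)
    = (\<Sum>p\<in>{..<n} \<times> {..<n}. if p = (i, j) \<or> p = (j, i) then a i j / 2 else 0)"
    unfolding quadratic_def lookup_sum sum.cartesian_product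
    by (rule sum.cong) (use sym in \<open>auto simp: lookup_single when_def unit_vec_expo_add_eq_iff split: if_splits\<close>)
  \<comment> \<open>Off the diagonal two pairs contribute half an entry each. On the diagonal the
    set is a singleton, and the missing factor 2 comes from \<open>rho\<close>.\<close>
  also have "\<dots> = (\<Sum>p\<in>{(i, j), (j, i)}. a i j / 2)"
    using ij by (intro sum.mono_neutral_cong_right) (auto split: if_splits)
  finally show ?thesis by (cases "i = j") (simp_all add: rho_unit_vec_expo_add)
qed

lemma lookup_poly_pderiv:
  "lookup (poly_pderiv j q) \<beta> = real (lookup \<beta> j + 1) * lookup q (\<beta> + \<e> j)"
proof -
  have "lookup (poly_pderiv j q) \<beta>
    = (\<Sum>\<alpha>\<in>keys q. if \<alpha> = \<beta> + \<e> j then real (lookup \<beta> j + 1) * lookup q (\<beta> + \<e> j) else 0)"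
    unfolding poly_pderiv_def lookup_sum
  proof (rule sum.cong)
    fix \<alpha>
    \<comment> \<open>Truncated subtraction is invertible only if \<open>j\<close> occurs in
      \<open>\<alpha>\<close>; otherwise the derivative has coefficient 0 there.\<close>
    have "\<alpha> = \<alpha> - \<e> j + \<e> j" if "lookup \<alpha> j \<noteq> 0"
      using that by (intro poly_mapping_eqI) (auto simp: lookup_add lookup_minus lookup_single when_def)
    thus "lookup (Poly_Mapping.single (\<alpha> - \<e> j) (real (lookup \<alpha> j) * lookup q \<alpha>)) \<beta>
      = (if \<alpha> = \<beta> + \<e> j then real (lookup \<beta> j + 1) * lookup q (\<beta> + \<e> j) else 0)"
      by (cases "lookup \<alpha> j = 0") (auto simp: lookup_single when_def lookup_add)
  qed simp
  also have "\<dots> = real (lookup \<beta> j + 1) * lookup q (\<beta> + \<e> j)"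
    by (auto simp: in_keys_iff)
  finally show ?thesis .
qed

text \<open>The factor 2 from differentiating a square twice is the factorial in \<open>rho\<close>,
  so normalized coefficients are exactly Hessian entries.\<close>

lemma quadratic_hessian_eq: "quadratic_hessian n q = mat n n (\<lambda>(i, j). rho q (\<e> i + \<e> j))"
  unfolding quadratic_hessian_def
  by (rule eq_matI)
     (auto simp: lookup_poly_pderiv rho_unit_vec_expo_add lookup_single when_def add.commute)

lemma poly_pderivs_0: "poly_pderivs n 0 f = f"
proof -
  have "fold (\<lambda>i. poly_pderiv i ^^ lookup 0 i) is f = f" for "is" :: "nat list"
    by (induct "is") auto
  thus ?thesis by (simp add: poly_pderivs_def)
qed

lemma lorentzian_2_iff:
  "lorentzian n 2 f \<longleftrightarrow> f \<noteq> 0 \<and> homogeneous n 2 f \<and> nonneg_coeffs f \<and> M_convex n 2 (keys f) \<and>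
     \<not> pos_def_plane n (\<lambda>i j. rho f (\<e> i + \<e> j))"
  by (simp add: lorentzian_def Delta_0 poly_pderivs_0 quadratic_hessian_eq
      at_most_one_pos_eigenvalue_iff add.commute)

section \<open>Classes and simplification\<close>

text \<open>An exchange could only fail by producing a square that is missing from \<open>K\<close>.
  The choice of \<open>j\<close> avoids this, whichever squares \<open>K\<close> contains; it serves
  for \<open>J_simp\<close>.\<close>

lemma M_convex_of_complete_graph:
  assumes sub: "K \<subseteq> Delta r 2" and ne: "K \<noteq> {}"
    and K: "\<And>s t. s < r \<Longrightarrow> t < r \<Longrightarrow> s \<noteq> t \<Longrightarrow> \<e> s + \<e> t \<in> K"
  shows "M_convex r 2 K"
  unfolding M_convex_def
proof (intro conjI ballI allI impI sub ne)
  fix \<alpha> \<beta> i assume \<alpha>: "\<alpha> \<in> K" and \<beta>: "\<beta> \<in> K" and i: "i < r" and less: "lookup \<alpha> i < lookup \<beta> i"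
  obtain a b where ab: "\<alpha> = \<e> a + \<e> b" "a < r" "b < r" using \<alpha> sub by (auto simp: Delta_2)
  obtain c where c: "\<beta> = \<e> i + \<e> c" "c < r"
  proof -
    obtain c d where cd: "\<beta> = \<e> c + \<e> d" "c < r" "d < r" using \<beta> sub by (auto simp: Delta_2)
    hence "i = c \<or> i = d" using less by (auto simp: lookup_unit_vec_expo_add split: if_splits)
    thus ?thesis using cd that by (auto simp: add.commute)
  qed
  have ex: "\<exists>j<r. lookup \<beta> j < lookup \<alpha> j \<and> \<alpha> + \<e> i - \<e> j \<in> K \<and> \<beta> - \<e> i + \<e> j \<in> K"
    if a: "\<alpha> = \<e> j + \<e> k" "j < r" "lookup \<beta> j < lookup \<alpha> j" "\<e> k + \<e> i \<in> K" "\<e> c + \<e> j \<in> K" for j k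
    using that c by (intro exI[of _ j]) (auto simp: add.assoc)
  \<comment> \<open>In the first two cases both new monomials are squarefree. In the other three the
    move interchanges \<open>\<alpha>\<close> and \<open>\<beta>\<close>.\<close>
  consider "a \<noteq> i" "b \<noteq> i" "a \<noteq> c" | "a \<noteq> i" "b \<noteq> i" "b \<noteq> c" | "a \<noteq> i" "a = b" "b = c"
    | "c = i" "a = i" "b \<noteq> i" | "c = i" "b = i" "a \<noteq> i"
    using less ab c by (auto simp: lookup_unit_vec_expo_add split: if_splits)
  thus "\<exists>j<r. lookup \<beta> j < lookup \<alpha> j \<and> \<alpha> + \<e> i - \<e> j \<in> K \<and> \<beta> - \<e> i + \<e> j \<in> K"
  proof cases
    case 1
    thus ?thesis using ab c i K by (intro ex[of a b]) (auto simp: lookup_unit_vec_expo_add)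
  next
    case 2
    thus ?thesis using ab c i K
      by (intro ex[of b a]) (auto simp: lookup_unit_vec_expo_add add.commute[of "\<e> a" "\<e> b"])
  next
    case 3
    thus ?thesis using ab c i K \<alpha> by (intro ex[of c c]) (auto simp: lookup_unit_vec_expo_add)
  next
    case 4
    thus ?thesis using ab c i K \<beta>
      by (intro ex[of b a]) (auto simp: lookup_unit_vec_expo_add add.commute[of "\<e> i" "\<e> b"])
  next
    case 5
    thus ?thesis using ab c i K \<beta> by (intro ex[of a b]) (auto simp: lookup_unit_vec_expo_add)
  qed
qed

text \<open>The exchange axiom for the graph with loops whose edges are the elements of
  \<open>J\<close>: raising coordinate \<open>c\<close> in \<open>\<e> a + \<e> b\<close> must lower
  \<open>a\<close> or \<open>b\<close>, so a vertex \<open>c\<close> that lies on some edge is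
  adjacent to an end of every edge avoiding it.\<close>

lemma exchange:
  assumes M: "M_convex n 2 J" and "\<e> a + \<e> b \<in> J" "\<e> c + \<e> d \<in> J" "c \<noteq> a" "c \<noteq> b" "c < n"
  shows "\<e> c + \<e> a \<in> J \<or> \<e> c + \<e> b \<in> J"
proof -
  have "lookup (\<e> a + \<e> b) c < lookup (\<e> c + \<e> d) c"
    using assms by (auto simp: lookup_unit_vec_expo_add)
  then obtain j where j: "lookup (\<e> a + \<e> b) j > lookup (\<e> c + \<e> d) j" "\<e> a + \<e> b + \<e> c - \<e> j \<in> J"
    using M assms unfolding M_convex_def by blast
  from j(1) have "j = a \<or> j = b" by (auto simp: lookup_unit_vec_expo_add split: if_splits)
  moreover have "\<e> a + \<e> b + \<e> c - \<e> a = \<e> c + \<e> b" "\<e> a + \<e> b + \<e> c - \<e> b = \<e> c + \<e> a"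
  proof -
    have "\<e> a + \<e> b + \<e> c = \<e> a + (\<e> c + \<e> b)" "\<e> a + \<e> b + \<e> c = \<e> b + (\<e> c + \<e> a)"
      by (simp_all only: ac_simps)
    thus "\<e> a + \<e> b + \<e> c - \<e> a = \<e> c + \<e> b" "\<e> a + \<e> b + \<e> c - \<e> b = \<e> c + \<e> a"
      by (metis add_diff_cancel_left')+
  qed
  ultimately show ?thesis using j(2) by auto
qed

locale M_convex_quadratic =
  fixes n r :: nat and J :: "expo set" and W :: "nat \<Rightarrow> nat set"
  assumes M_convex: "M_convex n 2 J" and numbering: "class_numbering n J r W"
begin

abbreviation edge :: "nat \<Rightarrow> nat \<Rightarrow> bool" where "edge i j \<equiv> \<e> i + \<e> j \<in> J"
abbreviation V :: "nat set" where "V \<equiv> V_set n J"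
abbreviation p :: "nat \<Rightarrow> nat" where "p \<equiv> class_index r W"

lemma edge_commute: "edge i j \<longleftrightarrow> edge j i"
  by (simp add: add.commute)

lemma edge_V: "edge i j \<Longrightarrow> i \<in> V \<and> j \<in> V"
proof -
  assume e: "edge i j"
  hence "\<e> i + \<e> j \<in> Delta n 2" using M_convex by (auto simp: M_convex_def)
  hence "i < n" "j < n" by (auto simp: Delta_2 unit_vec_expo_add_eq_iff)
  thus ?thesis using e edge_commute by (auto simp: V_set_def)
qed

lemma V_edge: "i \<in> V \<Longrightarrow> \<exists>j. edge i j"
  by (auto simp: V_set_def)

lemma V_less: "i \<in> V \<Longrightarrow> i < n"
  by (auto simp: V_set_def)

lemma finite_V: "finite V"
  by (auto simp: V_set_def)

text \<open>The case \<open>a = b = i\<close> of \<open>exchange\<close>. Consequently a vertex with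
  a loop is a class of its own.\<close>

lemma loop_edge: "edge i i \<Longrightarrow> j \<in> V \<Longrightarrow> i \<noteq> j \<Longrightarrow> edge i j"
  using exchange[OF M_convex, of i i j] V_edge[of j] V_less[of j] edge_commute[of i j] by blast

text \<open>Non-adjacency, made reflexive, is already transitive: if \<open>i\<close> and
  \<open>k\<close> were adjacent, \<open>exchange\<close> would make \<open>j\<close> adjacent to
  one of them. So generating an equivalence relation adds nothing beyond the diagonal.\<close>

lemma parallel_rel_eq: "parallel_rel n J = {(i, j). i \<in> V \<and> j \<in> V \<and> (i = j \<or> \<not> edge i j)}"
  (is "_ = ?P")
proof
  have "trans ?P"
  proof (rule transI, clarsimp)
    fix i j k assume "i \<in> V" "j \<in> V" "k \<in> V" "i = j \<or> \<not> edge i j" "j = k \<or> \<not> edge j k" "edge i k" "i \<noteq> k"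
    thus False
      using exchange[OF M_convex, of i k j] V_edge[of j] V_less[of j] edge_commute[of i j] by blast
  qed
  hence "equiv V ?P"
    by (intro equivI) (auto simp: refl_on_def sym_def edge_commute)
  thus "parallel_rel n J \<subseteq> ?P" unfolding parallel_rel_def by (intro Inter_lower) auto
  show "?P \<subseteq> parallel_rel n J"
    unfolding parallel_rel_def by (intro Inter_greatest) (auto simp: equiv_def refl_on_def)
qed

lemma equiv_parallel_rel: "equiv V (parallel_rel n J)"
proof -
  have "trans (parallel_rel n J)" "sym (parallel_rel n J)"
    unfolding parallel_rel_def by (auto simp: equiv_def intro!: trans_INTER[of _ id, simplified] sym_INTER[of _ id, simplified])
  thus ?thesis
    by (intro equivI) (auto simp: refl_on_def parallel_rel_eq)
qed

lemma W_quotient: "s < r \<Longrightarrow> W s \<in> V // parallel_rel n J"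
  using numbering by (auto simp: class_numbering_def bij_betw_def)

lemma W_subset: "s < r \<Longrightarrow> W s \<subseteq> V"
  using W_quotient equiv_parallel_rel in_quotient_imp_subset by blast

lemma finite_W: "s < r \<Longrightarrow> finite (W s)"
  using W_subset finite_V finite_subset by blast

lemma W_nonempty: "s < r \<Longrightarrow> W s \<noteq> {}"
  using W_quotient equiv_parallel_rel in_quotient_imp_non_empty by blast

lemma W_disjoint: "s < r \<Longrightarrow> t < r \<Longrightarrow> s \<noteq> t \<Longrightarrow> W s \<inter> W t = {}"
  using quotient_disj[OF equiv_parallel_rel W_quotient W_quotient, of s t] numbering
  by (auto simp: class_numbering_def bij_betw_def inj_on_def)

lemma UN_W: "(\<Union>s<r. W s) = V"
  using Union_quotient[OF equiv_parallel_rel] numbering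
  by (auto simp: class_numbering_def bij_betw_def)

lemma p_eq: "s < r \<Longrightarrow> i \<in> W s \<Longrightarrow> p i = s"
  unfolding class_index_def using W_disjoint by (intro the_equality) blast+

lemma p_less: "i \<in> V \<Longrightarrow> p i < r" and p_W: "i \<in> V \<Longrightarrow> i \<in> W (p i)"
  using UN_W p_eq by auto

lemma p_eq_iff:
  assumes "i \<in> V" "j \<in> V"
  shows "p i = p j \<longleftrightarrow> i = j \<or> \<not> edge i j"
proof
  assume "p i = p j"
  hence "(i, j) \<in> parallel_rel n J"
    using in_quotient_imp_in_rel[OF equiv_parallel_rel W_quotient[OF p_less[OF assms(1)]], of i j]
      p_W[OF assms(1)] p_W[OF assms(2)] by auto
  thus "i = j \<or> \<not> edge i j" by (auto simp: parallel_rel_eq)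
next
  assume "i = j \<or> \<not> edge i j"
  hence "(i, j) \<in> parallel_rel n J" using assms by (auto simp: parallel_rel_eq)
  hence "W (p i) = W (p j)"
    using quotient_eqI[OF equiv_parallel_rel W_quotient W_quotient p_W p_W] p_less assms by blast
  thus "p i = p j" using p_W p_less p_eq assms by metis
qed

section \<open>Substitution of linear forms supported on the classes\<close>

lemma sum_W: "(\<Sum>s<r. \<Sum>i\<in>W s. h i) = sum h V"
  for h :: "nat \<Rightarrow> 'a::comm_monoid_add"
  unfolding UN_W[symmetric] using W_disjoint finite_W by (subst sum.UNION_disjoint) auto

lemma sum_W_double: "(\<Sum>s<r. \<Sum>t<r. \<Sum>i\<in>W s. \<Sum>k\<in>W t. h s t i k) = (\<Sum>i\<in>V. \<Sum>k\<in>V. h (p i) (p k) i k)"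
  for h :: "nat \<Rightarrow> nat \<Rightarrow> nat \<Rightarrow> nat \<Rightarrow> 'a::comm_monoid_add"
proof -
  have "(\<Sum>s<r. \<Sum>t<r. \<Sum>i\<in>W s. \<Sum>k\<in>W t. h s t i k) = (\<Sum>s<r. \<Sum>t<r. \<Sum>i\<in>W s. \<Sum>k\<in>W t. h (p i) (p k) i k)"
    by (intro sum.cong refl) (simp add: p_eq)
  also have "\<dots> = (\<Sum>s<r. \<Sum>i\<in>W s. \<Sum>t<r. \<Sum>k\<in>W t. h (p i) (p k) i k)"
    by (intro sum.cong refl sum.swap)
  finally show ?thesis by (simp add: sum_W)
qed

lemma sum_lessThan_V:
  fixes h :: "nat \<Rightarrow> 'a::comm_monoid_add"
  assumes "\<And>i. i < n \<Longrightarrow> i \<notin> V \<Longrightarrow> h i = 0"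
  shows "sum h {..<n} = sum h V"
  using assms V_less by (intro sum.mono_neutral_right) auto

lemma poly_subst_classes:
  assumes "homogeneous r 2 g"
  shows "poly_subst (\<lambda>j. \<Sum>i\<in>W j. polyconst (lam i) * polyvar i) g
    = quadratic n (\<lambda>i k. if i \<in> V \<and> k \<in> V then lam i * lam k * rho g (\<e> (p i) + \<e> (p k)) else 0)"
    (is "_ = quadratic n ?a")
proof -
  have "poly_subst (\<lambda>j. \<Sum>i\<in>W j. polyconst (lam i) * polyvar i) g
    = (\<Sum>s<r. \<Sum>t<r. \<Sum>i\<in>W s. \<Sum>k\<in>W t.
        Poly_Mapping.single (\<e> i + \<e> k) (lam i * lam k * rho g (\<e> s + \<e> t) / 2))"
    unfolding poly_subst_quadratic[OF assms]
    unfolding sum_product unfolding sum_distrib_left polyconst_def polyvar_def mult_single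
    by (intro sum.cong refl) (simp add: mult_ac)
  also have "\<dots> = (\<Sum>i\<in>V. \<Sum>k\<in>V. Poly_Mapping.single (\<e> i + \<e> k)
      (lam i * lam k * rho g (\<e> (p i) + \<e> (p k)) / 2))"
    by (rule sum_W_double)
  also have "\<dots> = (\<Sum>i\<in>V. \<Sum>k\<in>V. Poly_Mapping.single (\<e> i + \<e> k) (?a i k / 2))"
    by (intro sum.cong refl) simp
  also have "\<dots> = (\<Sum>i<n. \<Sum>k<n. Poly_Mapping.single (\<e> i + \<e> k) (?a i k / 2))"
    by (subst sum_lessThan_V, simp, intro sum.cong refl sum_lessThan_V[symmetric], simp)
  finally show ?thesis by (simp add: quadratic_def)
qed

text \<open>Replaces the polynomial identity by an identity between Hessian entries. Entries with an
  index outside \<open>V\<close> vanish on both sides.\<close>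

lemma poly_subst_classes_eq_iff:
  assumes "homogeneous r 2 g" and "homogeneous n 2 f" and "keys f = J"
  shows "f = poly_subst (\<lambda>j. \<Sum>i\<in>W j. polyconst (lam i) * polyvar i) g \<longleftrightarrow>
    (\<forall>i\<in>V. \<forall>k\<in>V. rho f (\<e> i + \<e> k) = lam i * lam k * rho g (\<e> (p i) + \<e> (p k)))"
    (is "_ \<longleftrightarrow> ?R")
proof -
  define a where "a i k = (if i \<in> V \<and> k \<in> V then lam i * lam k * rho g (\<e> (p i) + \<e> (p k)) else 0)" for i k
  have sym: "a k i = a i k" for i k by (simp add: a_def add.commute mult_ac)
  have off: "rho f (\<e> i + \<e> k) = 0" if "\<not> (i \<in> V \<and> k \<in> V)" for i k
  proof -
    have "\<e> i + \<e> k \<notin> keys f" using that edge_V[of i k] assms(3) by auto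
    thus ?thesis by (simp add: rho_unit_vec_expo_add in_keys_iff)
  qed
  have "f = quadratic n a \<longleftrightarrow> (\<forall>i<n. \<forall>k<n. rho f (\<e> i + \<e> k) = a i k)"
    using quadratic_eqI[OF assms(2) homogeneous_quadratic, of a] rho_quadratic[of a, OF sym] by auto
  also have "\<dots> \<longleftrightarrow> ?R"
    using off V_less by (auto simp: a_def)
  finally show ?thesis unfolding poly_subst_classes[OF assms(1)] a_def .
qed

lemma quad_form_classes:
  assumes on: "\<And>i k. i \<in> V \<Longrightarrow> k \<in> V \<Longrightarrow> a i k = lam i * lam k * b (p i) (p k)"
    and off: "\<And>i k. \<not> (i \<in> V \<and> k \<in> V) \<Longrightarrow> a i k = 0"
  shows "quad_form n a x = quad_form r b (\<lambda>s. \<Sum>i\<in>W s. lam i * x i)"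
proof -
  have "quad_form r b (\<lambda>s. \<Sum>i\<in>W s. lam i * x i)
    = (\<Sum>s<r. \<Sum>t<r. \<Sum>i\<in>W s. \<Sum>k\<in>W t. b s t * (lam i * x i) * (lam k * x k))"
    by (simp add: quad_form_def sum_product sum_distrib_left mult_ac)
  also have "\<dots> = (\<Sum>i\<in>V. \<Sum>k\<in>V. b (p i) (p k) * (lam i * x i) * (lam k * x k))"
    by (rule sum_W_double)
  also have "\<dots> = (\<Sum>i\<in>V. \<Sum>k\<in>V. a i k * x i * x k)"
    by (intro sum.cong refl) (simp add: on mult_ac)
  also have "\<dots> = (\<Sum>i\<in>V. \<Sum>k<n. a i k * x i * x k)"
    by (intro sum.cong refl sum_lessThan_V[symmetric]) (simp add: off)
  also have "\<dots> = quad_form n a x"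
    unfolding quad_form_def by (rule sum_lessThan_V[symmetric]) (simp add: off)
  finally show ?thesis by simp
qed

text \<open>A plane for \<open>a\<close> is pushed forward by the weighted class sums. Conversely,
  \<open>z\<close> is lifted to the function \<open>z (p i)\<close>, constant on classes; as the
  weights of each class sum to 1, this is a right inverse of the class sums.\<close>

lemma pos_def_plane_classes:
  assumes on: "\<And>i k. i \<in> V \<Longrightarrow> k \<in> V \<Longrightarrow> a i k = lam i * lam k * b (p i) (p k)"
    and off: "\<And>i k. \<not> (i \<in> V \<and> k \<in> V) \<Longrightarrow> a i k = 0"
    and lam: "\<And>s. s < r \<Longrightarrow> sum lam (W s) = 1"
  shows "pos_def_plane n a \<longleftrightarrow> pos_def_plane r b"
proof
  have qf: "quad_form n a z = quad_form r b (\<lambda>s. \<Sum>i\<in>W s. lam i * z i)" for z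
    using on off by (rule quad_form_classes)
  assume "pos_def_plane n a"
  then obtain x y where xy: "\<And>s t. s \<noteq> 0 \<or> t \<noteq> 0 \<Longrightarrow> quad_form n a (\<lambda>i. s * x i + t * y i) > 0"
    unfolding pos_def_plane_def by auto
  define x' y' where "x' u = (\<Sum>i\<in>W u. lam i * x i)" and "y' u = (\<Sum>i\<in>W u. lam i * y i)" for u
  have "quad_form n a (\<lambda>i. s * x i + t * y i) = quad_form r b (\<lambda>u. s * x' u + t * y' u)" for s t
    unfolding qf x'_def y'_def
    by (simp add: sum.distrib sum_distrib_left algebra_simps)
  thus "pos_def_plane r b" using xy by (intro pos_def_planeI[of r b x' y']) simp
next
  assume "pos_def_plane r b"
  then obtain x y where xy: "\<And>s t. s \<noteq> 0 \<or> t \<noteq> 0 \<Longrightarrow> quad_form r b (\<lambda>i. s * x i + t * y i) > 0"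
    unfolding pos_def_plane_def by auto
  have "quad_form n a (\<lambda>i. z (p i)) = quad_form r b z" for z
  proof -
    have "(\<Sum>i\<in>W s. lam i * z (p i)) = z s" if "s < r" for s
      using lam[OF that] that by (simp add: p_eq flip: sum_distrib_right)
    hence "quad_form r b (\<lambda>s. \<Sum>i\<in>W s. lam i * z (p i)) = quad_form r b z"
      unfolding quad_form_def by (intro sum.cong refl) simp
    thus ?thesis using quad_form_classes[of a lam b "\<lambda>i. z (p i)"] on off by simp
  qed
  from this[of "\<lambda>i. s * x i + t * y i" for s t] show "pos_def_plane n a"
    using xy by (intro pos_def_planeI[of n a "\<lambda>i. x (p i)" "\<lambda>i. y (p i)"]) simp
qed

section \<open>The simplification is M-convex\<close>

lemma mem_J_simp_iff:
  "\<e> s + \<e> t \<in> J_simp n J r W \<longleftrightarrow> s < r \<and> t < r \<and> (s \<noteq> t \<or> (\<exists>i\<in>W s. edge i i))"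
proof -
  have D: "i \<in> D_set n J \<longleftrightarrow> edge i i" for i
    using edge_V[of i i] V_less by (auto simp: D_set_def unit_vec_expo_double)
  have "\<e> s + \<e> t \<in> J_simp n J r W \<longleftrightarrow> (s = t \<and> (\<exists>i. edge i i \<and> p i = s)) \<or> (s < r \<and> t < r \<and> s \<noteq> t)"
    unfolding J_simp_def D unit_vec_expo_double[symmetric]
    by (auto simp: unit_vec_expo_add_eq_iff)
  moreover have "(\<exists>i. edge i i \<and> p i = s) \<longleftrightarrow> s < r \<and> (\<exists>i\<in>W s. edge i i)"
    using edge_V p_W p_less p_eq by metis
  ultimately show ?thesis by auto
qed

lemma J_simp_subset: "J_simp n J r W \<subseteq> Delta r 2"
proof
  fix \<alpha> assume \<alpha>: "\<alpha> \<in> J_simp n J r W"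
  then obtain s t where "\<alpha> = \<e> s + \<e> t"
    by (auto simp: J_simp_def simp flip: unit_vec_expo_double)
  thus "\<alpha> \<in> Delta r 2" using \<alpha> by (auto simp: mem_J_simp_iff Delta_2)
qed

lemma M_convex_J_simp: "M_convex r 2 (J_simp n J r W)"
proof (rule M_convex_of_complete_graph[OF J_simp_subset])
  obtain \<alpha> where "\<alpha> \<in> J" "\<alpha> \<in> Delta n 2" using M_convex by (auto simp: M_convex_def)
  then obtain i j where ij: "edge i j" by (auto simp: Delta_2)
  hence V: "i \<in> V" "j \<in> V" using edge_V by auto
  \<comment> \<open>Either \<open>i\<close> and \<open>j\<close> lie in different classes, or
    \<open>i = j\<close> and the edge is a loop.\<close>
  have "\<e> (p i) + \<e> (p j) \<in> J_simp n J r W"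
    using V ij p_less p_W p_eq_iff[OF V] by (auto simp: mem_J_simp_iff)
  thus "J_simp n J r W \<noteq> {}" by auto
qed (simp add: mem_J_simp_iff)

end

section \<open>Factorization\<close>

locale strong_T_inf_quadratic = M_convex_quadratic +
  fixes f :: rpoly
  assumes homogeneous_f: "homogeneous n 2 f" and nonneg_f: "nonneg_coeffs f"
    and keys_f: "keys f = J" and strong_T_inf: "strong_T_inf_rep n J (rho f)"
begin

definition hess :: "nat \<Rightarrow> nat \<Rightarrow> real" where "hess i j = rho f (\<e> i + \<e> j)"
definition weight :: "nat \<Rightarrow> real" where "weight i = (\<Sum>k<n. hess i k)"
definition lam :: "nat \<Rightarrow> real" where
  "lam = (\<lambda>i\<in>V. weight i / (\<Sum>j\<in>W (p i). weight j))"
definition block_sum :: "nat \<Rightarrow> nat \<Rightarrow> real" where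
  "block_sum s t = (\<Sum>i\<in>W s. \<Sum>k\<in>W t. hess i k)"

lemma hess_commute: "hess i j = hess j i"
  by (simp add: hess_def add.commute)

lemma hess_nonneg: "hess i j \<ge> 0"
  using nonneg_f by (simp add: hess_def rho_unit_vec_expo_add nonneg_coeffs_def)

lemma hess_eq_0_iff: "hess i j = 0 \<longleftrightarrow> \<not> edge i j"
  using keys_f by (auto simp: hess_def rho_unit_vec_expo_add in_keys_iff)

lemma weight_pos: "i \<in> V \<Longrightarrow> weight i > 0"
proof -
  assume "i \<in> V"
  then obtain k where k: "edge i k" using V_edge by blast
  hence "k < n" using edge_V V_less by blast
  moreover have "hess i k > 0" using k hess_nonneg[of i k] hess_eq_0_iff[of i k] by linarith
  ultimately show ?thesis
    unfolding weight_def by (intro sum_pos2[of _ k]) (auto simp: hess_nonneg)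
qed

text \<open>For distinct \<open>k\<close> and \<open>l\<close> in \<open>V\<close> outside the
  common class of distinct \<open>i\<close> and \<open>j\<close>, the product containing
  \<open>hess i j\<close> is zero. The three products are then not all nonzero, and two nonnegative
  numbers together with 0 attain their maximum twice only if the two agree. For other columns both
  sides vanish or coincide.\<close>

lemma hess_minor_eq_0:
  assumes i: "i \<in> V" "j \<in> V" "p i = p j"
  shows "hess i k * hess j l = hess j k * hess i l"
proof (cases "i = j")
  case False
  \<comment> \<open>A loop at \<open>i\<close> or \<open>j\<close> would make the two
    adjacent.\<close>
  have no: "\<not> edge i j" "\<not> edge i i" "\<not> edge j j"
    using i False p_eq_iff[of i j] loop_edge[of i j] loop_edge[of j i] edge_commute[of i j] by auto
  have cls: "hess i m = 0 \<and> hess j m = 0" if "\<not> (m \<in> V \<and> p m \<noteq> p i)" for m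
    using that i no p_eq_iff[of i m] p_eq_iff[of j m] edge_V[of i m] edge_V[of j m]
    by (auto simp: hess_eq_0_iff)
  show ?thesis
  proof (cases "(k \<in> V \<and> p k \<noteq> p i) \<and> (l \<in> V \<and> p l \<noteq> p i) \<and> k \<noteq> l")
    case True
    hence kl: "k \<in> V" "l \<in> V" "p k \<noteq> p i" "p l \<noteq> p i" "k \<noteq> l" by auto
    hence dist: "i \<noteq> k" "i \<noteq> l" "j \<noteq> k" "j \<noteq> l" using i by auto
    \<comment> \<open>The four indices are distinct, so the left side is at most 1, and every vertex
      of \<open>V\<close> occurs in some element of \<open>J\<close>.\<close>
    have max: "lookup (\<e> i + \<e> j + \<e> k + \<e> l) m \<le> Max ((\<lambda>\<alpha>. lookup \<alpha> m) ` J)" for m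
    proof (cases "m \<in> {i, j, k, l}")
      case True
      then obtain m' where m': "edge m m'" using V_edge i kl by blast
      have "lookup (\<e> i + \<e> j + \<e> k + \<e> l) m \<le> 1"
        using True False dist kl(5) by (auto simp: lookup_add lookup_single when_def)
      also have "1 \<le> lookup (\<e> m + \<e> m') m" by (simp add: lookup_unit_vec_expo_add)
      also have "\<dots> \<le> Max ((\<lambda>\<alpha>. lookup \<alpha> m) ` J)"
        using m' by (intro Max_ge) (auto simp flip: keys_f)
      finally show ?thesis .
    next
      case False
      thus ?thesis by (auto simp: lookup_add lookup_single when_def)
    qed
    have "i < n" "j < n" "k < n" "l < n" using i kl V_less by auto
    hence "T_inf_triple (hess j k * hess i l) (hess i k * hess j l) (hess i j * hess k l)"
      using strong_T_inf[unfolded strong_T_inf_rep_def, THEN conjunct2, THEN conjunct2] max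
      unfolding hess_def by simp
    moreover have "hess i j = 0" using no by (simp add: hess_eq_0_iff)
    moreover have "hess j k * hess i l \<ge> 0" "hess i k * hess j l \<ge> 0"
      by (simp_all add: hess_nonneg)
    ultimately show ?thesis by (auto simp: T_inf_triple_def Let_def max_def split: if_splits)
  next
    case False
    thus ?thesis using cls[of k] cls[of l] by (auto simp: mult.commute)
  qed
qed (simp add: mult.commute)

lemma hess_weight:
  assumes "i \<in> V" "j \<in> V" "p i = p j"
  shows "hess i k * weight j = hess j k * weight i"
  unfolding weight_def sum_distrib_left using hess_minor_eq_0[OF assms] by simp

lemma sum_weight_pos: "s < r \<Longrightarrow> (\<Sum>i\<in>W s. weight i) > 0"
  using finite_W W_nonempty W_subset[of s] weight_pos by (intro sum_pos) auto

text \<open>Sum \<open>hess_weight\<close> over the class of \<open>i\<close> and divide by its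
  total weight: \<open>lam i\<close> is the share of row \<open>i\<close> in the sum of the rows of
  its class.\<close>

lemma hess_row:
  assumes "i \<in> V"
  shows "hess i k = lam i * (\<Sum>j\<in>W (p i). hess j k)"
proof -
  have "hess i k * (\<Sum>j\<in>W (p i). weight j) = (\<Sum>j\<in>W (p i). hess j k) * weight i"
    unfolding sum_distrib_left sum_distrib_right
  proof (rule sum.cong)
    fix j assume "j \<in> W (p i)"
    thus "hess i k * weight j = hess j k * weight i"
      using assms W_subset[OF p_less[OF assms]] p_eq[OF p_less[OF assms]] by (intro hess_weight) auto
  qed simp
  thus ?thesis
    using sum_weight_pos[OF p_less[OF assms]] assms by (simp add: lam_def field_simps)
qed

lemma hess_eq:
  assumes "i \<in> V" "k \<in> V"
  shows "hess i k = lam i * lam k * block_sum (p i) (p k)"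
proof -
  have "hess j k = lam k * (\<Sum>l\<in>W (p k). hess j l)" for j
    using hess_row[OF assms(2), of j] by (simp only: hess_commute[of _ j])
  hence "hess i k = lam i * (\<Sum>j\<in>W (p i). lam k * (\<Sum>l\<in>W (p k). hess j l))"
    using hess_row[OF assms(1), of k] by simp
  thus ?thesis by (simp add: block_sum_def sum_distrib_left mult_ac)
qed

lemma lam_pos: "i \<in> V \<Longrightarrow> lam i > 0"
  using weight_pos sum_weight_pos p_less by (simp add: lam_def)

lemma sum_lam: "s < r \<Longrightarrow> (\<Sum>i\<in>W s. lam i) = 1"
proof -
  assume s: "s < r"
  have "(\<Sum>i\<in>W s. lam i) = (\<Sum>i\<in>W s. weight i / (\<Sum>j\<in>W s. weight j))"
    using s W_subset p_eq by (intro sum.cong) (auto simp: lam_def)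
  thus ?thesis using sum_weight_pos[OF s] by (simp flip: sum_divide_distrib)
qed

lemma block_sum_commute: "block_sum s t = block_sum t s"
  unfolding block_sum_def by (subst sum.swap) (intro sum.cong refl hess_commute)

lemma block_sum_nonneg: "block_sum s t \<ge> 0"
  unfolding block_sum_def by (intro sum_nonneg) (simp add: hess_nonneg)

text \<open>Entries are nonnegative, so a block sum vanishes only if the block contains no edge.
  Between different classes all pairs are edges; inside a class only loops are. This identifies the
  support of \<open>simp_poly\<close>.\<close>

lemma block_sum_eq_0_iff:
  assumes "s < r" "t < r"
  shows "block_sum s t = 0 \<longleftrightarrow> \<e> s + \<e> t \<notin> J_simp n J r W"
proof -
  have "block_sum s t = 0 \<longleftrightarrow> (\<forall>i\<in>W s. \<forall>k\<in>W t. \<not> edge i k)"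
    unfolding block_sum_def using assms finite_W
    by (simp add: sum_nonneg_eq_0_iff sum_nonneg hess_nonneg hess_eq_0_iff)
  moreover have "(\<exists>i\<in>W s. \<exists>k\<in>W t. edge i k) \<longleftrightarrow> s \<noteq> t \<or> (\<exists>i\<in>W s. edge i i)"
  proof (cases "s = t")
    case True
    have "i = k" if "i \<in> W s" "k \<in> W s" "edge i k" for i k
      using that p_eq_iff[of i k] edge_V p_eq assms by metis
    thus ?thesis using True by blast
  next
    case False
    obtain i k where ik: "i \<in> W s" "k \<in> W t" using W_nonempty assms by blast
    hence "i \<in> V" "k \<in> V" "p i \<noteq> p k" using W_subset assms p_eq False by auto
    thus ?thesis using ik False p_eq_iff by blast
  qed
  ultimately show ?thesis using assms by (auto simp: mem_J_simp_iff)
qed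

section \<open>Existence and uniqueness of the factorization, and the Lorentzian property\<close>

definition simp_poly :: rpoly where "simp_poly = quadratic r block_sum"

lemma rho_simp_poly: "s < r \<Longrightarrow> t < r \<Longrightarrow> rho simp_poly (\<e> s + \<e> t) = block_sum s t"
  unfolding simp_poly_def by (rule rho_quadratic[OF block_sum_commute])

lemma homogeneous_simp_poly: "homogeneous r 2 simp_poly"
  unfolding simp_poly_def by (rule homogeneous_quadratic)

lemma lookup_simp_poly:
  assumes "s < r" "t < r"
  shows "lookup simp_poly (\<e> s + \<e> t) = block_sum s t / (if s = t then 2 else 1)"
  using rho_simp_poly[OF assms] by (auto simp: rho_unit_vec_expo_add split: if_splits)

lemma nonneg_simp_poly: "nonneg_coeffs simp_poly"
  unfolding nonneg_coeffs_def
proof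
  fix \<alpha>
  show "lookup simp_poly \<alpha> \<ge> 0"
  proof (cases "\<alpha> \<in> Delta r 2")
    case True
    thus ?thesis by (auto simp: Delta_2 lookup_simp_poly block_sum_nonneg)
  next
    case False
    hence "\<alpha> \<notin> keys simp_poly" using homogeneous_simp_poly by (auto simp: homogeneous_def)
    thus ?thesis by (simp add: in_keys_iff)
  qed
qed

lemma keys_simp_poly: "keys simp_poly = J_simp n J r W"
proof -
  have "\<alpha> \<in> keys simp_poly \<longleftrightarrow> \<alpha> \<in> J_simp n J r W" if \<alpha>: "\<alpha> \<in> Delta r 2" for \<alpha>
  proof -
    obtain s t where "\<alpha> = \<e> s + \<e> t" "s < r" "t < r" using \<alpha> unfolding Delta_2 by blast
    thus ?thesis by (simp add: in_keys_iff lookup_simp_poly block_sum_eq_0_iff)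
  qed
  moreover have "keys simp_poly \<subseteq> Delta r 2" using homogeneous_simp_poly by (simp add: homogeneous_def)
  ultimately show ?thesis using J_simp_subset by blast
qed

lemma simp_factorization_iff:
  "simp_factorization n J r W f g l \<longleftrightarrow>
     homogeneous r 2 g \<and> nonneg_coeffs g \<and> keys g = J_simp n J r W \<and> l \<in> V \<rightarrow>\<^sub>E {0<..} \<and>
     (\<forall>s<r. sum l (W s) = 1) \<and>
     (\<forall>i\<in>V. \<forall>k\<in>V. hess i k = l i * l k * rho g (\<e> (p i) + \<e> (p k)))"
  unfolding simp_factorization_def hess_def
  using poly_subst_classes_eq_iff[OF _ homogeneous_f keys_f, of g l] by auto

lemma simp_factorization_simp_poly: "simp_factorization n J r W f simp_poly lam"
  unfolding simp_factorization_iff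
  using homogeneous_simp_poly nonneg_simp_poly keys_simp_poly sum_lam hess_eq p_less lam_pos
  by (auto simp: rho_simp_poly lam_def PiE_iff)

text \<open>Summing the entry identity over a pair of classes removes \<open>l\<close>, whose class
  sums are 1, and leaves the block sums as the Hessian of \<open>g\<close>. Row sums are then
  \<open>l i\<close> times a factor depending only on the class, so normalizing them recovers
  \<open>l\<close>.\<close>

lemma simp_factorization_unique:
  assumes "simp_factorization n J r W f g l"
  shows "g = simp_poly" and "l = lam"
proof -
  have g: "homogeneous r 2 g" and l: "l \<in> V \<rightarrow>\<^sub>E {0<..}"
    and sum: "\<And>s. s < r \<Longrightarrow> sum l (W s) = 1"
    and h: "\<And>i k. i \<in> V \<Longrightarrow> k \<in> V \<Longrightarrow> hess i k = l i * l k * rho g (\<e> (p i) + \<e> (p k))"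
    using assms unfolding simp_factorization_iff by auto
  have "block_sum s t = rho g (\<e> s + \<e> t)" if st: "s < r" "t < r" for s t
  proof -
    have "block_sum s t = (\<Sum>i\<in>W s. \<Sum>k\<in>W t. l i * l k * rho g (\<e> s + \<e> t))"
      unfolding block_sum_def
    proof (intro sum.cong refl)
      fix i k assume "i \<in> W s" "k \<in> W t"
      thus "hess i k = l i * l k * rho g (\<e> s + \<e> t)"
        using h[of i k] W_subset[OF st(1)] W_subset[OF st(2)] p_eq st by auto
    qed
    also have "\<dots> = sum l (W s) * sum l (W t) * rho g (\<e> s + \<e> t)"
      unfolding sum_product unfolding sum_distrib_right by simp
    finally show ?thesis using sum st by simp
  qed
  thus "g = simp_poly"
    by (intro quadratic_eqI[OF g homogeneous_simp_poly]) (simp add: rho_simp_poly)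
  \<comment> \<open>This common factor turns out to be the total weight of the class
    \<open>s\<close>.\<close>
  define c where "c s = (\<Sum>k\<in>V. l k * rho g (\<e> s + \<e> (p k)))" for s
  have w: "weight i = l i * c (p i)" if "i \<in> V" for i
  proof -
    have "weight i = (\<Sum>k\<in>V. hess i k)"
      unfolding weight_def by (rule sum_lessThan_V) (use edge_V in \<open>auto simp: hess_eq_0_iff\<close>)
    also have "\<dots> = l i * c (p i)"
      unfolding c_def sum_distrib_left by (intro sum.cong refl) (simp add: h that)
    finally show ?thesis .
  qed
  \<comment> \<open>Both functions are extensional on \<open>V\<close>, so comparing them on
    \<open>V\<close> suffices.\<close>
  show "l = lam"
  proof (rule extensionalityI[of _ V])
    fix i assume i: "i \<in> V"
    have "(\<Sum>j\<in>W (p i). weight j) = (\<Sum>j\<in>W (p i). l j * c (p i))"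
      using W_subset[OF p_less[OF i]] p_eq[OF p_less[OF i]] by (intro sum.cong refl) (auto simp: w)
    also have "\<dots> = c (p i)" using sum[OF p_less[OF i]] by (simp flip: sum_distrib_right)
    finally have "lam i = l i * c (p i) / c (p i)" using i by (simp add: lam_def w)
    moreover have "c (p i) \<noteq> 0" using w[OF i] weight_pos[OF i] by auto
    ultimately show "l i = lam i" by simp
  qed (use l in \<open>auto simp: lam_def PiE_def\<close>)
qed

text \<open>Both supports are M-convex and both polynomials have nonnegative coefficients, so only
  the absence of a positive definite plane is at stake, and \<open>pos_def_plane_classes\<close>
  transfers it.\<close>

lemma lorentzian_iff_simp_poly: "lorentzian n 2 f \<longleftrightarrow> lorentzian r 2 simp_poly"
proof -
  have nz: "q \<noteq> 0" if "M_convex m 2 (keys q)" for q :: rpoly and m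
    using that by (auto simp: M_convex_def)
  have rho: "rho simp_poly (\<e> (p i) + \<e> (p k)) = block_sum (p i) (p k)" if "i \<in> V" "k \<in> V" for i k
    using that p_less by (simp add: rho_simp_poly)
  have "pos_def_plane n hess \<longleftrightarrow> pos_def_plane r (\<lambda>s t. rho simp_poly (\<e> s + \<e> t))"
    by (rule pos_def_plane_classes[of _ lam])
      (use hess_eq rho edge_V sum_lam in \<open>auto simp: hess_eq_0_iff\<close>)
  thus ?thesis
    unfolding lorentzian_2_iff hess_def
    using nz[of n f] nz[of r simp_poly] M_convex M_convex_J_simp keys_f keys_simp_poly
      homogeneous_f nonneg_f homogeneous_simp_poly nonneg_simp_poly by auto
qed

end

theorem theorem4p7:
  fixes n r :: nat and J :: "expo set" and W :: "nat \<Rightarrow> nat set" and f :: rpoly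
  assumes "M_convex n 2 J"
    and "class_numbering n J r W"
    and "homogeneous n 2 f" and "nonneg_coeffs f" and "keys f = J"
    and "strong_T_inf_rep n J (rho f)"
  shows "\<exists>g lam. simp_factorization n J r W f g lam \<and>
           (\<forall>g' lam'. simp_factorization n J r W f g' lam' \<longrightarrow> g' = g \<and> lam' = lam) \<and>
           (lorentzian n 2 f \<longleftrightarrow> lorentzian r 2 g)"
proof -
  interpret strong_T_inf_quadratic n r J W f by unfold_locales (fact assms)+
  show ?thesis
    using simp_factorization_simp_poly simp_factorization_unique lorentzian_iff_simp_poly by blast
qed

end
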